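(* Let $\Gamma\subset\mathbb{R}^d$ be an acute closed convex solid cone, $\mu$ a positive measure of moderate growth on $\Gamma^*$, $\lambda\in\operatorname{int}\Gamma$ and $n\in\mathbb{N}$. Let $H_n$, $u$ and the compressed coordinate multipliers $X^{(n)}_1,\dots,X^{(n)}_d$ on $H_n$ be as in the context, and put $A_j=X_j^{(n)}$, $A=(A_1,\dots,A_d)$, $L(x)=x\cdot A$. Assume that $L(p)$ is positive semi-definite for every vector $p$ lying on an extreme ray of $\Gamma$, and that there exist $d$ linearly independent vectors $v^{(1)},\dots,v^{(d)}$ chosen from the extreme rays of $\Gamma$ such that for all $i,j\in\{1,\dots,d\}$ the Weyl-symmetrized words $C_{k,1}(L(v^{(i)}),L(v^{(j)}))$ are positive semi-definite for all $k\ge1$. Then the entire function $\langle\exp(-(z-\lambda)\cdot A)u,u\rangle$ is a finite positive linear combination of exponentials on the tube domain $T_{\lambda+\Gamma}=(\lambda+\operatorname{int}\Gamma)+i\mathbb{R}^d$, i.e. $$\langle\exp(-(z-\lambda)\cdot A)u,u\rangle=\sum_{j=1}^{\dim H_n}\gamma_j\exp(-(z-\lambda)\cdot\lambda^{(j)}),$$ where $\gamma_j\ge0$ and $\lambda^{(j)}\in\Gamma^*$.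
   Context: Acute means containing no line; solid means with non-empty interior. $\Gamma^*=\{y\in\mathbb{R}^d: y\cdot x\ge 0\ \forall x\in\Gamma\}$. A nonnegative measure $\mu$ on $\Gamma^*$ is of moderate growth if $e^{-p\cdot x}\in L^1(\Gamma^*,\mu)$ for every $p\in\operatorname{int}\Gamma$. $H_n=\operatorname{span}_{\mathbb{R}}\{x^\alpha e^{-\frac{\lambda}{2}\cdot x}:\alpha\in\mathbb{N}_0^d,\ |\alpha|\le n\}\subset L^2_{\mathbb{R}}(\Gamma^*,\mu)$, $u=e^{-\frac{\lambda}{2}\cdot x}\in H_n$, $P_n$ is the orthogonal projection of $L^2_{\mathbb{R}}(\Gamma^*,\mu)$ onto $H_n$, and $X^{(n)}_j=P_nX_jP_n$ restricted to $H_n$, where $X_j$ is multiplication by the coordinate $x_j$. These are real symmetric operators on the finite-dimensional real Hilbert space $H_n$ (complexified when needed). For operators $X,Y$, $C_{k,1}(X,Y)=\sum_{j=0}^kX^{k-j}YX^j$, the coefficient of $s^kt$ in $(sX+tY)^{k+1}$. *)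

theory Defs
  imports "HOL-Analysis.Analysis"
begin

section \<open>Cones\<close>

text \<open>\<open>\<real>\<^sup>d\<close> is \<open>real ^ 'd\<close>.\<close>

definition acute :: "'a::real_vector set \<Rightarrow> bool" where
  "acute \<Gamma> \<longleftrightarrow> (\<nexists>a v. v \<noteq> 0 \<and> range (\<lambda>t::real. a + t *\<^sub>R v) \<subseteq> \<Gamma>)"

definition solid :: "'a::topological_space set \<Rightarrow> bool" where
  "solid \<Gamma> \<longleftrightarrow> interior \<Gamma> \<noteq> {}"

definition dual_cone :: "'a::real_inner set \<Rightarrow> 'a set" where
  "dual_cone \<Gamma> = {y. \<forall>x\<in>\<Gamma>. y \<bullet> x \<ge> 0}"

definition extreme_ray_of :: "'a::real_vector set \<Rightarrow> 'a set \<Rightarrow> bool" where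
  "extreme_ray_of R \<Gamma> \<longleftrightarrow>
     (\<exists>v. v \<noteq> 0 \<and> R = (\<lambda>t::real. t *\<^sub>R v) ` {0..}) \<and> R face_of \<Gamma>"

definition on_extreme_ray :: "'a::real_vector \<Rightarrow> 'a set \<Rightarrow> bool" where
  "on_extreme_ray p \<Gamma> \<longleftrightarrow> (\<exists>R. extreme_ray_of R \<Gamma> \<and> p \<in> R)"

text \<open>A Borel measure on \<open>\<Gamma>\<^sup>*\<close> is a measure whose \<open>\<sigma>\<close>-algebra is that of
  \<open>restrict_space borel (dual_cone \<Gamma>)\<close>; in particular its \<open>space\<close> is \<open>dual_cone \<Gamma>\<close>.\<close>

definition moderate_growth :: "(real ^ 'd) set \<Rightarrow> (real ^ 'd) measure \<Rightarrow> bool" where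
  "moderate_growth \<Gamma> M \<longleftrightarrow>
     sets M = sets (restrict_space borel (dual_cone \<Gamma>)) \<and>
     (\<forall>p\<in>interior \<Gamma>. integrable M (\<lambda>x. exp (- (p \<bullet> x))))"

section \<open>Square-integrable functions modulo null sets\<close>

text \<open>Elements of \<open>L\<^sup>2(\<mu>)\<close> are represented by functions, identified when they agree
  almost everywhere. All notions below respect this identification. Vectors of a subspace
  \<open>H\<close> are likewise represented by the functions in a set \<open>H\<close>, and operators act on
  representatives.\<close>

definition l2_inner :: "'a measure \<Rightarrow> ('a \<Rightarrow> real) \<Rightarrow> ('a \<Rightarrow> real) \<Rightarrow> real" where
  "l2_inner M f g = (LINT x|M. f x * g x)"

definition l2_inner_c :: "'a measure \<Rightarrow> ('a \<Rightarrow> complex) \<Rightarrow> ('a \<Rightarrow> complex) \<Rightarrow> complex" where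
  "l2_inner_c M f g = (LINT x|M. f x * cnj (g x))"

definition ae_basis :: "'a measure \<Rightarrow> ('a \<Rightarrow> real) set \<Rightarrow> ('a \<Rightarrow> real) set \<Rightarrow> bool" where
  "ae_basis M H B \<longleftrightarrow>
     finite B \<and> B \<subseteq> H \<and>
     (\<forall>c :: ('a \<Rightarrow> real) \<Rightarrow> real.
        (AE x in M. (\<Sum>b\<in>B. c b * b x) = 0) \<longrightarrow> (\<forall>b\<in>B. c b = 0)) \<and>
     (\<forall>f\<in>H. \<exists>c :: ('a \<Rightarrow> real) \<Rightarrow> real. AE x in M. f x = (\<Sum>b\<in>B. c b * b x))"

text \<open>The dimension of the image of \<open>H\<close> in \<open>L\<^sup>2(\<mu>)\<close>. It may be smaller than the dimension
  of \<open>H\<close> as a space of functions, for instance if \<open>\<mu>\<close> has finite support.\<close>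

definition ae_dim :: "'a measure \<Rightarrow> ('a \<Rightarrow> real) set \<Rightarrow> nat" where
  "ae_dim M H = card (SOME B. ae_basis M H B)"

text \<open>A representative of the orthogonal projection onto a finite-dimensional \<open>H\<close>; it is
  determined by its defining property up to equality almost everywhere.\<close>

definition orth_proj ::
    "'a measure \<Rightarrow> ('a \<Rightarrow> real) set \<Rightarrow> ('a \<Rightarrow> real) \<Rightarrow> 'a \<Rightarrow> real" where
  "orth_proj M H f =
     (SOME h. h \<in> H \<and> (\<forall>g\<in>H. l2_inner M (\<lambda>x. f x - h x) g = 0))"

definition pos_semidef_on ::
    "'a measure \<Rightarrow> ('a \<Rightarrow> real) set \<Rightarrow> (('a \<Rightarrow> real) \<Rightarrow> 'a \<Rightarrow> real) \<Rightarrow> bool" where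
  "pos_semidef_on M H T \<longleftrightarrow>
     (\<forall>f\<in>H. \<forall>g\<in>H. l2_inner M (T f) g = l2_inner M f (T g)) \<and>
     (\<forall>f\<in>H. l2_inner M (T f) f \<ge> 0)"

definition weyl_word ::
    "nat \<Rightarrow> (('a \<Rightarrow> real) \<Rightarrow> 'a \<Rightarrow> real) \<Rightarrow> (('a \<Rightarrow> real) \<Rightarrow> 'a \<Rightarrow> real) \<Rightarrow>
      ('a \<Rightarrow> real) \<Rightarrow> 'a \<Rightarrow> real" where
  "weyl_word k X Y = (\<lambda>f x. \<Sum>j\<le>k. ((X ^^ (k - j)) \<circ> Y \<circ> (X ^^ j)) f x)"

section \<open>Complexification and the operator exponential\<close>

definition complexify_space :: "('a \<Rightarrow> real) set \<Rightarrow> ('a \<Rightarrow> complex) set" where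
  "complexify_space H = {f. (\<lambda>x. Re (f x)) \<in> H \<and> (\<lambda>x. Im (f x)) \<in> H}"

definition complexify_op ::
    "(('a \<Rightarrow> real) \<Rightarrow> 'a \<Rightarrow> real) \<Rightarrow> ('a \<Rightarrow> complex) \<Rightarrow> 'a \<Rightarrow> complex" where
  "complexify_op T f = (\<lambda>x. Complex (T (\<lambda>y. Re (f y)) x) (T (\<lambda>y. Im (f y)) x))"

text \<open>\<open>exp(T) f\<close> is the limit in \<open>L\<^sup>2(\<mu>)\<close> of the partial sums of \<open>\<Sum> T\<^sup>k f / k!\<close>,
  again as a representative. For an operator on a finite-dimensional \<open>H\<close> the limit exists,
  and is unique up to equality almost everywhere.\<close>

definition op_exp ::
    "'a measure \<Rightarrow> ('a \<Rightarrow> complex) set \<Rightarrow> (('a \<Rightarrow> complex) \<Rightarrow> 'a \<Rightarrow> complex) \<Rightarrow>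
      ('a \<Rightarrow> complex) \<Rightarrow> 'a \<Rightarrow> complex" where
  "op_exp M H T f =
     (SOME g. g \<in> H \<and>
       (\<lambda>m. LINT x|M. (cmod ((\<Sum>k<m. (T ^^ k) f x / fact k) - g x))\<^sup>2) \<longlonglongrightarrow> 0)"

section \<open>The spaces \<open>H\<^sub>n\<close> and the compressed coordinate multipliers\<close>

definition vac :: "real ^ 'd \<Rightarrow> real ^ 'd \<Rightarrow> real" where
  "vac l = (\<lambda>x. exp (- (((1 / 2) *\<^sub>R l) \<bullet> x)))"

definition Hsp :: "real ^ 'd \<Rightarrow> nat \<Rightarrow> (real ^ 'd \<Rightarrow> real) set" where
  "Hsp l n =
     {(\<lambda>x. \<Sum>\<alpha>\<in>{\<alpha> :: 'd \<Rightarrow> nat. (\<Sum>i\<in>UNIV. \<alpha> i) \<le> n}.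
             c \<alpha> * ((\<Prod>i\<in>UNIV. (x $ i) ^ \<alpha> i) * vac l x)) | c :: ('d \<Rightarrow> nat) \<Rightarrow> real. True}"

definition compressed_coord ::
    "(real ^ 'd) measure \<Rightarrow> real ^ 'd \<Rightarrow> nat \<Rightarrow> 'd \<Rightarrow>
      (real ^ 'd \<Rightarrow> real) \<Rightarrow> real ^ 'd \<Rightarrow> real" where
  "compressed_coord M l n j =
     (\<lambda>f. orth_proj M (Hsp l n) (\<lambda>x. x $ j * orth_proj M (Hsp l n) f x))"

text \<open>\<open>L(p) = p \<cdot> A\<close> for real \<open>p\<close>, and \<open>w \<cdot> A\<close> on the complexification for complex \<open>w\<close>.\<close>

definition pencil ::
    "('d::finite \<Rightarrow> ('a \<Rightarrow> real) \<Rightarrow> 'a \<Rightarrow> real) \<Rightarrow> real ^ 'd \<Rightarrow>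
      ('a \<Rightarrow> real) \<Rightarrow> 'a \<Rightarrow> real" where
  "pencil A p = (\<lambda>f x. \<Sum>j\<in>UNIV. p $ j * A j f x)"

definition pencil_c ::
    "('d::finite \<Rightarrow> ('a \<Rightarrow> real) \<Rightarrow> 'a \<Rightarrow> real) \<Rightarrow> complex ^ 'd \<Rightarrow>
      ('a \<Rightarrow> complex) \<Rightarrow> 'a \<Rightarrow> complex" where
  "pencil_c A w = (\<lambda>f x. \<Sum>j\<in>UNIV. w $ j * complexify_op (A j) f x)"

definition of_real_vec :: "real ^ 'd \<Rightarrow> complex ^ 'd" where
  "of_real_vec x = (\<chi> j. of_real (x $ j))"

definition tube :: "real ^ 'd \<Rightarrow> (real ^ 'd) set \<Rightarrow> (complex ^ 'd) set" where
  "tube l \<Gamma> = {z. (\<chi> j. Re (z $ j)) \<in> (\<lambda>x. l + x) ` interior \<Gamma>}"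

text \<open>With \<open>l\<close> for \<open>\<lambda>\<close>, this is \<open>\<langle>exp(-(z - \<lambda>) \<cdot> A) u, u\<rangle>\<close>, where \<open>u = vac l\<close>.\<close>

definition exp_matrix_coeff ::
    "(real ^ 'd) measure \<Rightarrow> real ^ 'd \<Rightarrow> nat \<Rightarrow> complex ^ 'd \<Rightarrow> complex" where
  "exp_matrix_coeff M l n z =
     l2_inner_c M
       (op_exp M (complexify_space (Hsp l n))
          (pencil_c (compressed_coord M l n) (- (z - of_real_vec l)))
          (\<lambda>x. of_real (vac l x)))
       (\<lambda>x. of_real (vac l x))"

end

(*
The positivity of the Weyl words forces the operators L(v_i) to commute: if f and g are eigenvectors
of X with eigenvalues mu > nu >= 0, the 2x2 minor of C_{k,1}(X,Y) at f, g gives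
|<Yf,g>|^2 <= const * (k+1)^2 (nu/mu)^k for all k, so <Yf,g> = 0. As the v_i span, H_n has an
orthonormal basis e_a of joint eigenvectors of A_1, ..., A_d, with joint eigenvalues lambda_a, and the
matrix coefficient is the sum over a of <u,e_a>^2 exp(-(z - lambda).lambda_a). For p in Gamma,
p.lambda_a is the integral of (p.x) e_a(x)^2 over the dual cone, so lambda_a lies in the dual cone.
*)

theory Submission
  imports Defs "HOL-Computational_Algebra.Fundamental_Theorem_Algebra"
begin

text \<open>Projections and exponentials are chosen representatives, so the operators are linear
  only modulo null functions. The spectral theorem is therefore proved in that setting, for the span
  of any finite family with integrable pairwise products. The bound on \<open><Yf,g>\<close> comes
  from one asymmetry. In an eigenbasis of X, the k-th word multiplies the entry at f, g by the sum
  of \<nu>^(k-j) \<mu>^j. All terms are nonnegative, because L(p) is positive semi-definite on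
  extreme rays, so this factor is at least \<mu>^k. The diagonal factors are (k+1) \<mu>^k and (k+1)
  \<nu>^k, whose product is smaller than \<mu>^(2k) by a factor that decays exponentially when \<nu>
  < \<mu>. A single word in general only bounds the entry; the limit over k makes it vanish. Then Y
  preserves the eigenspaces of X, which is commutation. All integrals exist because \<lambda> . x
  dominates a multiple of the norm of x on the dual cone.\<close>

section \<open>Homogeneous linear systems, and real polynomials inside the complex ones\<close>

text \<open>Gaussian elimination: solving equation \<open>k\<close> for the unknown
  \<open>a p\<close> leaves a system with one equation and one unknown fewer. This is the dimension
  count behind both the existence of annihilating polynomials and the comparison of bases.\<close>

lemma homogeneous_system_nontrivial_solution:
  fixes c :: "'j \<Rightarrow> 'i \<Rightarrow> real"
  assumes "finite I" "finite J" "card I < card J"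
  shows "\<exists>a. (\<exists>j\<in>J. a j \<noteq> 0) \<and> (\<forall>i\<in>I. (\<Sum>j\<in>J. a j * c j i) = 0)"
  using assms
proof (induction I arbitrary: J c rule: finite_induct)
  case empty
  then have "J \<noteq> {}" by auto
  then show ?case by (intro exI[of _ "\<lambda>_. 1"]) auto
next
  case (insert k I)
  show ?case
  proof (cases "\<forall>j\<in>J. c j k = 0")
    case True
    have "card I < card J" using insert by simp
    then obtain a where "\<exists>j\<in>J. a j \<noteq> 0" "\<forall>i\<in>I. (\<Sum>j\<in>J. a j * c j i) = 0"
      using insert.IH insert.prems by blast
    then show ?thesis using True by (intro exI[of _ a]) auto
  next
    case False
    then obtain p where p: "p \<in> J" "c p k \<noteq> 0" by auto
    define J' where "J' = J - {p}"
    have J': "finite J'" "card I < card J'" "J = insert p J'" "p \<notin> J'"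
      using insert p by (auto simp: J'_def)
    define c' where "c' j i = c j i - c j k / c p k * c p i" for j i
    obtain a where a: "\<exists>j\<in>J'. a j \<noteq> 0" "\<forall>i\<in>I. (\<Sum>j\<in>J'. a j * c' j i) = 0"
      using insert.IH[OF J'(1,2)] by blast
    define b where "b = a(p := - (\<Sum>j\<in>J'. a j * c j k / c p k))"
    have b: "(\<Sum>j\<in>J. b j * c j i) =
        (\<Sum>j\<in>J'. a j * c j i) - (\<Sum>j\<in>J'. a j * c j k / c p k) * c p i" for i
    proof -
      have "(\<Sum>j\<in>J'. b j * c j i) = (\<Sum>j\<in>J'. a j * c j i)"
        using J'(4) by (intro sum.cong) (auto simp: b_def)
      then show ?thesis using J' by (simp add: b_def)
    qed
    have "(\<Sum>j\<in>J. b j * c j i) = 0" if "i \<in> insert k I" for i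
    proof (cases "i = k")
      case True
      then show ?thesis using p(2) unfolding b by (simp add: sum_distrib_right)
    next
      case False
      then have "(\<Sum>j\<in>J'. a j * c' j i) = 0" using that a(2) by auto
      then show ?thesis
        unfolding b by (simp add: c'_def algebra_simps sum_subtractf sum_distrib_left)
    qed
    moreover have "\<exists>j\<in>J. b j \<noteq> 0"
      using a(1) J' unfolding b_def by force
    ultimately show ?thesis by (intro exI[of _ b]) auto
  qed
qed

lemma map_poly_of_real_add:
  "map_poly of_real (p + q) = (map_poly of_real p + map_poly of_real q :: complex poly)"
  by (rule poly_eqI) (simp add: coeff_map_poly)

lemma map_poly_of_real_mult:
  "map_poly of_real (p * q) = (map_poly of_real p * map_poly of_real q :: complex poly)"
  by (rule poly_eqI) (simp add: coeff_map_poly coeff_mult)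

lemma poly_map_poly_of_real:
  "poly (map_poly of_real p) (of_real x :: complex) = of_real (poly p x)"
  by (induction p) (simp_all add: map_poly_pCons)

lemma l2_inner_commute: "l2_inner M f g = l2_inner M g f"
  by (simp add: l2_inner_def mult.commute)

section \<open>Inner products on the span of finitely many square-integrable functions\<close>

text \<open>Isolates what the spectral argument uses of \<open>Hsp l n\<close>. The generators may
  be dependent modulo null functions, so \<open>card I\<close> is only an upper bound for the
  dimension.\<close>

locale l2_span =
  fixes M :: "'a measure" and I :: "'i set" and \<phi> :: "'i \<Rightarrow> 'a \<Rightarrow> real"
  assumes finite_index: "finite I"
    and measurable_gen: "\<And>i. i \<in> I \<Longrightarrow> \<phi> i \<in> borel_measurable M"
    and integrable_gen: "\<And>i j. i \<in> I \<Longrightarrow> j \<in> I \<Longrightarrow> integrable M (\<lambda>x. \<phi> i x * \<phi> j x)"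
begin

definition H :: "('a \<Rightarrow> real) set" where
  "H = {(\<lambda>x. \<Sum>i\<in>I. c i * \<phi> i x) | c. True}"

abbreviation ip :: "('a \<Rightarrow> real) \<Rightarrow> ('a \<Rightarrow> real) \<Rightarrow> real" where
  "ip \<equiv> l2_inner M"

lemma H_lincomb:
  assumes "f \<in> H" "g \<in> H"
  shows "(\<lambda>x. a * f x + b * g x) \<in> H"
proof -
  obtain c d where "f = (\<lambda>x. \<Sum>i\<in>I. c i * \<phi> i x)" "g = (\<lambda>x. \<Sum>i\<in>I. d i * \<phi> i x)"
    using assms by (auto simp: H_def)
  then have "(\<lambda>x. a * f x + b * g x) = (\<lambda>x. \<Sum>i\<in>I. (a * c i + b * d i) * \<phi> i x)"
    by (simp add: sum.distrib sum_distrib_left algebra_simps)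
  then show ?thesis unfolding H_def by (intro CollectI exI[of _ "\<lambda>i. a * c i + b * d i"]) simp
qed

lemma H_zero: "(\<lambda>x. 0) \<in> H"
  unfolding H_def by (intro CollectI exI[of _ "\<lambda>_. 0"]) auto

lemma H_diff: "f \<in> H \<Longrightarrow> g \<in> H \<Longrightarrow> (\<lambda>x. f x - g x) \<in> H"
  using H_lincomb[of f g 1 "-1"] by simp

lemma H_scale: "f \<in> H \<Longrightarrow> (\<lambda>x. a * f x) \<in> H"
  using H_lincomb[OF _ H_zero, of f a 0] by simp

lemma H_sum:
  assumes "finite K" "\<And>k. k \<in> K \<Longrightarrow> f k \<in> H"
  shows "(\<lambda>x. \<Sum>k\<in>K. a k * f k x) \<in> H"
  using assms
proof (induction K rule: finite_induct)
  case empty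
  then show ?case using H_zero by simp
next
  case (insert k K)
  then show ?case using H_lincomb[of "f k" "\<lambda>x. \<Sum>k\<in>K. a k * f k x" "a k" 1] by simp
qed

lemma H_measurable: "f \<in> H \<Longrightarrow> f \<in> borel_measurable M"
  using measurable_gen by (auto simp: H_def)

lemma H_integrable:
  assumes "f \<in> H" "g \<in> H"
  shows "integrable M (\<lambda>x. f x * g x)"
proof -
  obtain c d where fg: "f = (\<lambda>x. \<Sum>i\<in>I. c i * \<phi> i x)" "g = (\<lambda>x. \<Sum>i\<in>I. d i * \<phi> i x)"
    using assms by (auto simp: H_def)
  have "(\<lambda>x. f x * g x) = (\<lambda>x. \<Sum>i\<in>I. \<Sum>j\<in>I. (c i * d j) * (\<phi> i x * \<phi> j x))"
    unfolding fg sum_product by (simp add: algebra_simps)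
  then show ?thesis
    by (auto intro!: Bochner_Integration.integrable_sum integrable_mult_right integrable_gen)
qed

lemma ip_lincomb:
  assumes "f \<in> H" "g \<in> H" "h \<in> H"
  shows "ip (\<lambda>x. a * f x + b * g x) h = a * ip f h + b * ip g h"
proof -
  have "(\<lambda>x. (a * f x + b * g x) * h x) = (\<lambda>x. a * (f x * h x) + b * (g x * h x))"
    by (simp add: algebra_simps)
  then show ?thesis
    unfolding l2_inner_def using H_integrable[OF assms(1,3)] H_integrable[OF assms(2,3)] by simp
qed

lemma ip_lincomb_right:
  assumes "f \<in> H" "g \<in> H" "h \<in> H"
  shows "ip h (\<lambda>x. a * f x + b * g x) = a * ip h f + b * ip h g"
  using ip_lincomb[OF assms] by (simp add: l2_inner_commute)

lemma ip_diff:
  assumes "f \<in> H" "g \<in> H" "h \<in> H"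
  shows "ip (\<lambda>x. f x - g x) h = ip f h - ip g h"
  using ip_lincomb[OF assms, of 1 "-1"] by simp

lemma ip_scale: "f \<in> H \<Longrightarrow> h \<in> H \<Longrightarrow> ip (\<lambda>x. a * f x) h = a * ip f h"
  using ip_lincomb[OF _ H_zero, of f h a 0] by simp

lemma ip_sum:
  assumes "finite K" "\<And>k. k \<in> K \<Longrightarrow> f k \<in> H" "h \<in> H"
  shows "ip (\<lambda>x. \<Sum>k\<in>K. a k * f k x) h = (\<Sum>k\<in>K. a k * ip (f k) h)"
  using assms
proof (induction K rule: finite_induct)
  case empty
  then show ?case by (simp add: l2_inner_def)
next
  case (insert k K)
  then show ?case
    using ip_lincomb[OF _ H_sum[of K f a], of "f k" h "a k" 1] by simp
qed

lemma ip_self_nonneg: "ip f f \<ge> 0"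
  unfolding l2_inner_def by (intro integral_nonneg_AE) auto

lemma ip_self_eq_0_iff:
  assumes "f \<in> H"
  shows "ip f f = 0 \<longleftrightarrow> (AE x in M. f x = 0)"
  unfolding l2_inner_def
  using integral_nonneg_eq_0_iff_AE[OF H_integrable[OF assms assms]] by simp

lemma ip_cong_AE:
  assumes "f \<in> borel_measurable M" "f' \<in> borel_measurable M" "g \<in> borel_measurable M"
    "AE x in M. f x = f' x"
  shows "ip f g = ip f' g"
  unfolding l2_inner_def using assms by (intro integral_cong_AE) auto

text \<open>The difference of f and g lies in \<open>H\<close> and can serve as its own test
  function. This is the bridge between weak identities and identities almost everywhere.\<close>

lemma AE_eq_iff_ip:
  assumes "f \<in> H" "g \<in> H"
  shows "(AE x in M. f x = g x) \<longleftrightarrow> (\<forall>h\<in>H. ip f h = ip g h)"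
proof
  assume "AE x in M. f x = g x"
  then show "\<forall>h\<in>H. ip f h = ip g h" using assms H_measurable by (auto intro: ip_cong_AE)
next
  assume *: "\<forall>h\<in>H. ip f h = ip g h"
  have d: "(\<lambda>x. f x - g x) \<in> H" using assms H_diff by auto
  have "ip (\<lambda>x. f x - g x) (\<lambda>x. f x - g x) = 0"
    using * d ip_diff[OF assms d] by simp
  then show "AE x in M. f x = g x" using ip_self_eq_0_iff[OF d] by simp
qed

section \<open>Symmetric operators and the existence of eigenvectors\<close>

lemma linearly_dependent_if_card_gt:
  assumes "finite J" "card I < card J" "\<And>j. j \<in> J \<Longrightarrow> f j \<in> H"
  shows "\<exists>a. (\<exists>j\<in>J. a j \<noteq> 0) \<and> (\<forall>x. (\<Sum>j\<in>J. a j * f j x) = 0)"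
proof -
  have "\<forall>j\<in>J. \<exists>c. f j = (\<lambda>x. \<Sum>i\<in>I. c i * \<phi> i x)" using assms(3) by (auto simp: H_def)
  then obtain c where c: "\<And>j. j \<in> J \<Longrightarrow> f j = (\<lambda>x. \<Sum>i\<in>I. c j i * \<phi> i x)" by metis
  obtain a where a: "\<exists>j\<in>J. a j \<noteq> 0" "\<forall>i\<in>I. (\<Sum>j\<in>J. a j * c j i) = 0"
    using homogeneous_system_nontrivial_solution[OF finite_index assms(1,2)] by blast
  have "(\<Sum>j\<in>J. a j * f j x) = 0" for x
  proof -
    have "(\<Sum>j\<in>J. a j * f j x) = (\<Sum>j\<in>J. \<Sum>i\<in>I. a j * c j i * \<phi> i x)"
      using c by (intro sum.cong) (auto simp: sum_distrib_left mult.assoc)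
    also have "\<dots> = (\<Sum>i\<in>I. (\<Sum>j\<in>J. a j * c j i) * \<phi> i x)"
      by (subst sum.swap) (simp add: sum_distrib_right)
    also have "\<dots> = 0" using a(2) by simp
    finally show ?thesis .
  qed
  then show ?thesis using a(1) by blast
qed

text \<open>All identities between operators are stated weakly, that is, tested against the elements
  of \<^term>\<open>H\<close>: operators act on representatives and are linear only up to null sets, and weak
  linearity of an operator follows from its symmetry.\<close>

definition symmetric_on :: "(('a \<Rightarrow> real) \<Rightarrow> 'a \<Rightarrow> real) \<Rightarrow> bool" where
  "symmetric_on T \<longleftrightarrow> (\<forall>f\<in>H. T f \<in> H) \<and> (\<forall>f\<in>H. \<forall>g\<in>H. ip (T f) g = ip f (T g))"

lemma symmetric_onD:
  assumes "symmetric_on T"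
  shows "f \<in> H \<Longrightarrow> T f \<in> H" "f \<in> H \<Longrightarrow> g \<in> H \<Longrightarrow> ip (T f) g = ip f (T g)"
  using assms by (auto simp: symmetric_on_def)

text \<open>Closure is meant literally, on functions. Eigenspaces and orthogonal complements qualify
  because the conditions that define them are weak.\<close>

definition lin_sub :: "('a \<Rightarrow> real) set \<Rightarrow> bool" where
  "lin_sub V \<longleftrightarrow> V \<subseteq> H \<and> (\<lambda>x. 0) \<in> V \<and>
     (\<forall>f\<in>V. \<forall>g\<in>V. \<forall>a b. (\<lambda>x. a * f x + b * g x) \<in> V)"

lemma lin_sub_lincomb:
  "lin_sub V \<Longrightarrow> f \<in> V \<Longrightarrow> g \<in> V \<Longrightarrow> (\<lambda>x. a * f x + b * g x) \<in> V"
  by (simp add: lin_sub_def)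

lemma lin_sub_sum:
  assumes "lin_sub V" "finite K" "\<And>k. k \<in> K \<Longrightarrow> f k \<in> V"
  shows "(\<lambda>x. \<Sum>k\<in>K. a k * f k x) \<in> V"
  using assms(2,3)
proof (induction K rule: finite_induct)
  case empty
  then show ?case using assms(1) by (simp add: lin_sub_def)
next
  case (insert k K)
  then have "f k \<in> V" "(\<lambda>x. \<Sum>k\<in>K. a k * f k x) \<in> V" by auto
  then show ?case
    using lin_sub_lincomb[OF assms(1), of "f k" "\<lambda>x. \<Sum>k\<in>K. a k * f k x" "a k" 1] insert by simp
qed

text \<open>For symmetric T a null function satisfies this with every \<mu>, so
  \<open>ip f f \<noteq> 0\<close> is stated separately wherever a genuine eigenvector is
  meant.\<close>

definition eigenvector :: "(('a \<Rightarrow> real) \<Rightarrow> 'a \<Rightarrow> real) \<Rightarrow> real \<Rightarrow> ('a \<Rightarrow> real) \<Rightarrow> bool" where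
  "eigenvector T \<mu> f \<longleftrightarrow> (\<forall>h\<in>H. ip (T f) h = \<mu> * ip f h)"

text \<open>A real polynomial of least degree annihilating a vector has no non-real root \<open>a + i b\<close>,
  since \<open>(T - a)\<^sup>2 + b\<^sup>2\<close> is injective modulo null functions for symmetric \<open>T\<close>; dividing out a
  real root leaves an eigenvector.\<close>

lemma eigenvector_exists:
  assumes T: "symmetric_on T" and V: "lin_sub V" "\<And>f. f \<in> V \<Longrightarrow> T f \<in> V"
    and v: "v \<in> V" "ip v v \<noteq> 0"
  shows "\<exists>f\<in>V. \<exists>\<mu>. ip f f \<noteq> 0 \<and> eigenvector T \<mu> f"
proof -
  \<comment> \<open>\<open>ev p\<close> is p(T)v and \<open>W p h\<close> its pairing with h.
    Multiplication of p by the variable has an exact rule only for \<open>W\<close>, since T is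
    linear merely modulo null functions.\<close>
  define ev where "ev p = (\<lambda>x. \<Sum>k\<le>degree p. coeff p k * (T ^^ k) v x)" for p :: "real poly"
  define W where "W p h = (\<Sum>k\<le>degree p. coeff p k * ip ((T ^^ k) v) h)" for p :: "real poly" and h
  have VH: "V \<subseteq> H" using V by (simp add: lin_sub_def)
  have pw: "(T ^^ k) v \<in> V" for k by (induction k) (use v V in auto)
  have evV: "ev p \<in> V" for p
    unfolding ev_def by (intro lin_sub_sum[OF V(1)]) (use pw in auto)
  have ip_ev: "ip (ev p) h = W p h" if "h \<in> H" for p h
    unfolding ev_def W_def by (intro ip_sum) (use pw VH that in auto)
  have Wext: "W p h = (\<Sum>k\<le>N. coeff p k * ip ((T ^^ k) v) h)" if "degree p \<le> N" for p h N
    unfolding W_def by (rule sum.mono_neutral_left) (use that in \<open>auto simp: coeff_eq_0\<close>)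
  have W_add: "W (p + q) h = W p h + W q h" for p q h
  proof -
    define N where "N = max (degree p) (degree q)"
    have "degree p \<le> N" "degree q \<le> N" "degree (p + q) \<le> N"
      by (auto simp: N_def intro: degree_add_le)
    then show ?thesis by (simp add: Wext sum.distrib algebra_simps)
  qed
  have W_smult: "W (smult a p) h = a * W p h" for a p h
    using Wext[of "smult a p" "degree p" h]
    by (simp add: W_def sum_distrib_left mult.assoc)
  \<comment> \<open>The variable acts on p(T)v as T, and symmetry moves T to the test
    function.\<close>
  have W_shift: "W (pCons 0 p) h = W p (T h)" if "h \<in> H" for p h
  proof -
    have "W (pCons 0 p) h = (\<Sum>k\<le>Suc (degree p). coeff (pCons 0 p) k * ip ((T ^^ k) v) h)"
      by (rule Wext) (simp add: degree_pCons_le)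
    also have "\<dots> = (\<Sum>k\<le>degree p. coeff p k * ip ((T ^^ Suc k) v) h)"
      by (subst sum.atMost_Suc_shift) simp
    also have "\<dots> = W p (T h)"
      unfolding W_def
    proof (rule sum.cong)
      fix k
      show "coeff p k * ip ((T ^^ Suc k) v) h = coeff p k * ip ((T ^^ k) v) (T h)"
        using symmetric_onD(2)[OF T, of "(T ^^ k) v" h] pw[of k] VH that by auto
    qed auto
    finally show ?thesis .
  qed
  define ann where "ann p \<longleftrightarrow> p \<noteq> 0 \<and> (\<forall>h\<in>H. W p h = 0)" for p
  have "\<exists>p. ann p"
  proof -
    \<comment> \<open>There are \<open>card I + 1\<close> iterates of v, one more than the
      generators, so some nonzero polynomial annihilates v.\<close>
    obtain a where a: "\<exists>j\<in>{..card I}. a j \<noteq> 0"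
        "\<forall>x. (\<Sum>j\<in>{..card I}. a j * (T ^^ j) v x) = 0"
      using linearly_dependent_if_card_gt[of "{..card I}" "\<lambda>k. (T ^^ k) v"] pw VH by auto
    define p where "p = (\<Sum>j\<le>card I. monom (a j) j)"
    have cp: "coeff p k = (if k \<le> card I then a k else 0)" for k
      unfolding p_def by (simp add: coeff_sum)
    have "p \<noteq> 0" using a(1) cp by (metis atMost_iff coeff_0)
    moreover have "W p h = 0" if "h \<in> H" for h
    proof -
      have "degree p \<le> card I" by (rule degree_le) (simp add: cp)
      then have "W p h = (\<Sum>j\<le>card I. a j * ip ((T ^^ j) v) h)"
        by (simp add: Wext cp)
      also have "\<dots> = ip (\<lambda>x. \<Sum>j\<le>card I. a j * (T ^^ j) v x) h"
        by (rule ip_sum[symmetric]) (use pw VH that in auto)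
      also have "\<dots> = 0" using a(2) by (simp add: l2_inner_def)
      finally show ?thesis .
    qed
    ultimately show ?thesis by (auto simp: ann_def)
  qed
  then obtain p where p: "ann p" "\<And>q. ann q \<Longrightarrow> degree p \<le> degree q"
    using ex_has_least_nat[of ann _ degree] by metis
  have nonnull: "ip (ev q) (ev q) \<noteq> 0" if q: "q \<noteq> 0" "degree q < degree p" for q
  proof
    assume "ip (ev q) (ev q) = 0"
    then have "AE x in M. ev q x = 0" using ip_self_eq_0_iff evV VH by blast
    then have "\<forall>h\<in>H. ip (ev q) h = ip (\<lambda>_. 0) h"
      using AE_eq_iff_ip[of "ev q" "\<lambda>_. 0"] evV VH H_zero by auto
    then have "\<forall>h\<in>H. W q h = 0" using ip_ev by (auto simp: l2_inner_def)
    then have "ann q" using q by (simp add: ann_def)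
    then show False using p(2) q by fastforce
  qed
  have "degree p \<noteq> 0"
  proof
    assume "degree p = 0"
    then have "W p v = coeff p 0 * ip v v" by (simp add: W_def)
    moreover have "coeff p 0 \<noteq> 0" using \<open>degree p = 0\<close> p(1)
      by (metis ann_def leading_coeff_0_iff)
    ultimately show False using p(1) v VH by (auto simp: ann_def)
  qed
  then have "\<not> constant (poly (map_poly complex_of_real p))"
    by (simp add: constant_degree degree_map_poly)
  then obtain z where z: "poly (map_poly complex_of_real p) z = 0"
    using fundamental_theorem_of_algebra by blast
  show ?thesis
  proof (cases "z \<in> \<real>")
    case True
    then obtain \<mu> where "z = of_real \<mu>" by (auto elim: Reals_cases)
    then have "poly p \<mu> = 0" using z by (simp add: poly_map_poly_of_real)
    then obtain q where q: "p = [:-\<mu>, 1:] * q" by (auto simp: poly_eq_0_iff_dvd)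
    have "q \<noteq> 0" using p(1) q by (auto simp: ann_def)
    moreover have "degree p = 1 + degree q"
      unfolding q using \<open>q \<noteq> 0\<close> by (subst degree_mult_eq) auto
    ultimately have q0: "q \<noteq> 0" "degree q < degree p" by auto
    have "eigenvector T \<mu> (ev q)"
      unfolding eigenvector_def
    proof
      fix h assume h: "h \<in> H"
      have "p = pCons 0 q + smult (-\<mu>) q" by (simp add: q)
      then have "W p h = W q (T h) - \<mu> * W q h" using W_shift[OF h, of q]
        by (simp only: W_add W_smult)
      then have "W q (T h) = \<mu> * W q h" using p(1) h by (simp add: ann_def)
      then show "ip (T (ev q)) h = \<mu> * ip (ev q) h"
        using h symmetric_onD[OF T] evV[of q] VH ip_ev by auto
    qed
    then show ?thesis using nonnull[OF q0] evV by blast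
  next
    case False
    define a b where "a = Re z" and "b = Im z"
    have b: "b \<noteq> 0" using False by (auto simp: b_def complex_is_Real_iff)
    \<comment> \<open>The real quadratic with roots z and its conjugate. The remainder of p modulo
      \<open>s\<close> is real of degree at most 1 and vanishes at the non-real z, so it is zero and
      \<open>s\<close> divides p.\<close>
    define s where "s = [:a\<^sup>2 + b\<^sup>2, - 2 * a, 1:]"
    have sz: "poly (map_poly complex_of_real s) z = 0"
      by (simp add: s_def a_def b_def map_poly_pCons complex_eq_iff power2_eq_square algebra_simps)
    define r where "r = p mod s"
    have "degree r < 2 \<or> r = 0" using degree_mod_less'[of s p] unfolding r_def s_def by auto
    then have "degree r \<le> 1" by auto
    define r0 r1 where "r0 = coeff r 0" and "r1 = coeff r 1"
    have r: "r = [:r0, r1:]"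
      using \<open>degree r \<le> 1\<close>
      by (intro poly_eqI) (auto simp: r0_def r1_def coeff_pCons coeff_eq_0 split: nat.splits)
    have "p = s * (p div s) + r" by (simp add: r_def)
    then have "poly (map_poly complex_of_real r) z = 0"
      using z sz map_poly_of_real_add[of "s * (p div s)" r] map_poly_of_real_mult[of s "p div s"]
      by simp
    then have "of_real r0 + z * of_real r1 = 0" by (simp add: r map_poly_pCons)
    then have "r0 = 0 \<and> r1 = 0" using b by (auto simp: b_def complex_eq_iff)
    define q where "q = p div s"
    have q: "p = s * q" using r \<open>r0 = 0 \<and> r1 = 0\<close> by (simp add: r_def q_def mod_eq_0_iff_dvd)
    have "q \<noteq> 0" "s \<noteq> 0" "degree s = 2" using p(1) q by (auto simp: ann_def s_def)
    moreover have "degree p = 2 + degree q"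
      unfolding q using \<open>q \<noteq> 0\<close> \<open>s \<noteq> 0\<close> \<open>degree s = 2\<close> by (subst degree_mult_eq) auto
    ultimately have q0: "q \<noteq> 0" "degree q < degree p" by auto
    define w where "w = ev q"
    have w: "w \<in> H" "T w \<in> H" "T (T w) \<in> H"
      using evV[of q] VH symmetric_onD(1)[OF T] by (auto simp: w_def)
    have "p = pCons 0 (pCons 0 q) + smult (- 2 * a) (pCons 0 q) + smult (a\<^sup>2 + b\<^sup>2) q"
      by (simp add: q s_def)
    then have "W p w = W q (T (T w)) + (- 2 * a) * W q (T w) + (a\<^sup>2 + b\<^sup>2) * W q w"
      by (simp only: W_add W_smult W_shift w)
    moreover have "W p w = 0" using p(1) w by (auto simp: ann_def)
    moreover have "W q (T (T w)) = ip (T w) (T w)" "W q (T w) = ip (T w) w" "W q w = ip w w"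
      using ip_ev[of _ q] w symmetric_onD(2)[OF T] unfolding w_def by auto
    ultimately have eq: "ip (T w) (T w) - 2 * a * ip (T w) w + (a\<^sup>2 + b\<^sup>2) * ip w w = 0"
      by simp
    \<comment> \<open>Completing the square: \<open>eq\<close> says that the squared norm of (T -
      a)w plus b^2 times that of w is zero, which is impossible since b is nonzero and w is not
      null.\<close>
    have "0 \<le> ip (\<lambda>x. 1 * T w x + (- a) * w x) (\<lambda>x. 1 * T w x + (- a) * w x)"
      by (rule ip_self_nonneg)
    also have "\<dots> = ip (T w) (T w) - 2 * a * ip (T w) w + a\<^sup>2 * ip w w"
      using w H_lincomb[OF w(2,1), of 1 "-a"] l2_inner_commute[of M w "T w"]
      by (simp only: ip_lincomb ip_lincomb_right) (simp add: algebra_simps power2_eq_square)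
    finally have "b\<^sup>2 * ip w w \<le> 0" using eq by (simp add: algebra_simps)
    moreover have "b\<^sup>2 * ip w w > 0"
      using b nonnull[OF q0] ip_self_nonneg[of w] unfolding w_def by simp
    ultimately show ?thesis by simp
  qed
qed


section \<open>Joint eigenvectors of commuting symmetric operators\<close>

text \<open>For symmetric S and T the two sides are \<open><TSf,g>\<close> and
  \<open><STf,g>\<close>; in this form no operators are composed.\<close>

definition commute_on ::
    "(('a \<Rightarrow> real) \<Rightarrow> 'a \<Rightarrow> real) \<Rightarrow> (('a \<Rightarrow> real) \<Rightarrow> 'a \<Rightarrow> real) \<Rightarrow> bool" where
  "commute_on S T \<longleftrightarrow> (\<forall>f\<in>H. \<forall>g\<in>H. ip (S f) (T g) = ip (T f) (S g))"

text \<open>An eigenspace of T inside V is invariant under every operator commuting with T, so the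
  induction continues inside that eigenspace. This is why V is arbitrary in the induction.\<close>

lemma joint_eigenvector_exists:
  assumes "finite F" "\<And>T. T \<in> F \<Longrightarrow> symmetric_on T"
    "\<And>S T. S \<in> F \<Longrightarrow> T \<in> F \<Longrightarrow> commute_on S T"
    "lin_sub V" "\<And>f T. T \<in> F \<Longrightarrow> f \<in> V \<Longrightarrow> T f \<in> V" "\<exists>v\<in>V. ip v v \<noteq> 0"
  shows "\<exists>f\<in>V. ip f f \<noteq> 0 \<and> (\<forall>T\<in>F. \<exists>\<mu>. eigenvector T \<mu> f)"
  using assms
proof (induction F arbitrary: V rule: finite_induct)
  case empty
  then show ?case by simp
next
  case (insert T F)
  have VH: "V \<subseteq> H" using insert.prems(3) by (simp add: lin_sub_def)
  have T: "symmetric_on T" using insert.prems by auto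
  obtain v where v: "v \<in> V" "ip v v \<noteq> 0" using insert.prems by auto
  obtain f \<mu> where f: "f \<in> V" "ip f f \<noteq> 0" "eigenvector T \<mu> f"
    using eigenvector_exists[OF T insert.prems(3) _ v] insert.prems(4) by auto
  define V' where "V' = {f \<in> V. eigenvector T \<mu> f}"
  have "lin_sub V'"
    unfolding lin_sub_def
  proof (intro conjI ballI allI)
    show "V' \<subseteq> H" using VH by (auto simp: V'_def)
    have "ip (T (\<lambda>x. 0)) h = \<mu> * ip (\<lambda>x. 0) h" if "h \<in> H" for h
      using symmetric_onD(2)[OF T H_zero that] by (simp add: l2_inner_def)
    then show "(\<lambda>x. 0) \<in> V'"
      using insert.prems(3) by (auto simp: V'_def lin_sub_def eigenvector_def)
    fix f g a b assume fg: "f \<in> V'" "g \<in> V'"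
    then have fgH: "f \<in> H" "g \<in> H" using VH by (auto simp: V'_def)
    have "ip (T (\<lambda>x. a * f x + b * g x)) h = \<mu> * ip (\<lambda>x. a * f x + b * g x) h"
      if h: "h \<in> H" for h
    proof -
      have "ip (T (\<lambda>x. a * f x + b * g x)) h = a * ip f (T h) + b * ip g (T h)"
        using symmetric_onD[OF T] H_lincomb[OF fgH, of a b] fgH h by (simp add: ip_lincomb)
      also have "\<dots> = a * (\<mu> * ip f h) + b * (\<mu> * ip g h)"
        using fg fgH h symmetric_onD(2)[OF T] by (simp add: V'_def eigenvector_def)
      also have "\<dots> = \<mu> * ip (\<lambda>x. a * f x + b * g x) h"
        using fgH h by (simp add: ip_lincomb algebra_simps)
      finally show ?thesis .
    qed
    then show "(\<lambda>x. a * f x + b * g x) \<in> V'"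
      using fg lin_sub_lincomb[OF insert.prems(3)] by (auto simp: V'_def eigenvector_def)
  qed
  moreover have "S f \<in> V'" if S: "S \<in> F" and f: "f \<in> V'" for S f
  proof -
    have fH: "f \<in> H" and fV: "f \<in> V" using f VH by (auto simp: V'_def)
    have sS: "symmetric_on S" and c: "commute_on T S" using insert.prems S by auto
    have "ip (T (S f)) h = \<mu> * ip (S f) h" if h: "h \<in> H" for h
    proof -
      have "ip (T (S f)) h = ip (S f) (T h)"
        using symmetric_onD[OF T] symmetric_onD[OF sS] fH h by simp
      also have "\<dots> = ip (T f) (S h)" using c fH h by (simp add: commute_on_def)
      also have "\<dots> = \<mu> * ip f (S h)"
        using f symmetric_onD[OF sS] h by (simp add: V'_def eigenvector_def)
      also have "\<dots> = \<mu> * ip (S f) h" using symmetric_onD[OF sS] fH h by simp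
      finally show ?thesis .
    qed
    then show ?thesis using insert.prems(4) S fV by (simp add: V'_def eigenvector_def)
  qed
  moreover have "\<exists>v\<in>V'. ip v v \<noteq> 0" using f by (auto simp: V'_def)
  ultimately obtain g where "g \<in> V'" "ip g g \<noteq> 0" "\<forall>T\<in>F. \<exists>\<mu>. eigenvector T \<mu> g"
    using insert.IH[of V'] insert.prems(1,2) by auto
  then show ?case by (intro bexI[of _ g]) (auto simp: V'_def)
qed

definition orthonormal :: "nat \<Rightarrow> (nat \<Rightarrow> 'a \<Rightarrow> real) \<Rightarrow> bool" where
  "orthonormal m e \<longleftrightarrow>
     (\<forall>a<m. e a \<in> H) \<and> (\<forall>a<m. \<forall>b<m. ip (e a) (e b) = (if a = b then 1 else 0))"

lemma orthonormalD:
  assumes "orthonormal m e"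
  shows "a < m \<Longrightarrow> e a \<in> H" "a < m \<Longrightarrow> b < m \<Longrightarrow> ip (e a) (e b) = (if a = b then 1 else 0)"
  using assms by (auto simp: orthonormal_def)

lemma ip_orthonormal_sum:
  assumes "orthonormal m e" "b < m"
  shows "ip (\<lambda>x. \<Sum>a<m. c a * e a x) (e b) = c b"
proof -
  have "ip (\<lambda>x. \<Sum>a<m. c a * e a x) (e b) = (\<Sum>a<m. c a * ip (e a) (e b))"
    using orthonormalD[OF assms(1)] assms(2) by (intro ip_sum) auto
  also have "\<dots> = (\<Sum>a<m. if a = b then c a else 0)"
    using orthonormalD[OF assms(1)] assms(2) by (intro sum.cong) auto
  finally show ?thesis using assms(2) by simp
qed

text \<open>Guarantees that a longest orthonormal system of joint eigenvectors exists.\<close>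

lemma orthonormal_le_card: "orthonormal m e \<Longrightarrow> m \<le> card I"
proof (rule ccontr)
  assume e: "orthonormal m e" and "\<not> m \<le> card I"
  then obtain a where a: "\<exists>j\<in>{..<m}. a j \<noteq> 0" "\<forall>x. (\<Sum>j<m. a j * e j x) = 0"
    using linearly_dependent_if_card_gt[of "{..<m}" e] orthonormalD by auto
  then show False using ip_orthonormal_sum[OF e, of _ a] by (auto simp: l2_inner_def)
qed

text \<open>For \<open>F = {}\<close> this is the Gram--Schmidt process.\<close>

lemma joint_eigenbasis_exists:
  assumes F: "finite F" "\<And>T. T \<in> F \<Longrightarrow> symmetric_on T"
    "\<And>S T. S \<in> F \<Longrightarrow> T \<in> F \<Longrightarrow> commute_on S T"
  shows "\<exists>m e. orthonormal m e \<and> (\<forall>a<m. \<forall>T\<in>F. \<exists>\<mu>. eigenvector T \<mu> (e a)) \<and>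
    (\<forall>f\<in>H. AE x in M. f x = (\<Sum>a<m. ip f (e a) * e a x))"
proof -
  define P where "P m \<longleftrightarrow> (\<exists>e. orthonormal m e \<and> (\<forall>a<m. \<forall>T\<in>F. \<exists>\<mu>. eigenvector T \<mu> (e a)))" for m
  have "P 0" by (auto simp: P_def orthonormal_def)
  moreover have "\<forall>m. P m \<longrightarrow> m \<le> card I" using orthonormal_le_card by (auto simp: P_def)
  ultimately obtain m where m: "P m" "\<And>k. P k \<Longrightarrow> k \<le> m"
    using Nat.ex_has_greatest_nat[of P 0 "card I"] by blast
  then obtain e where e: "orthonormal m e" "\<And>a T. a < m \<Longrightarrow> T \<in> F \<Longrightarrow> \<exists>\<mu>. eigenvector T \<mu> (e a)"
    unfolding P_def by blast
  note eH = orthonormalD(1)[OF e(1)]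
  \<comment> \<open>The orthogonal complement of a longest system is invariant under
    \<open>F\<close>. A non-null vector in it would yield one more joint eigenvector, so it contains
    only null functions, and every f agrees with its expansion.\<close>
  define V where "V = {f \<in> H. \<forall>a<m. ip f (e a) = 0}"
  have "lin_sub V"
    unfolding lin_sub_def V_def using H_zero H_lincomb eH
    by (auto simp: ip_lincomb) (simp add: l2_inner_def)
  have null: "ip v v = 0" if "v \<in> V" for v
  proof (rule ccontr)
    assume "ip v v \<noteq> 0"
    moreover have "T f \<in> V" if T: "T \<in> F" and f: "f \<in> V" for f T
    proof -
      have "ip (T f) (e a) = 0" if a: "a < m" for a
      proof -
        obtain \<mu> where \<mu>: "eigenvector T \<mu> (e a)" using e(2) a T by blast
        have "ip (T f) (e a) = ip (T (e a)) f"
          using symmetric_onD(2)[OF F(2)[OF T], of f "e a"] f eH[OF a] l2_inner_commute[of M f]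
          by (simp add: V_def)
        also have "\<dots> = \<mu> * ip f (e a)"
          using \<mu> f by (auto simp: V_def eigenvector_def l2_inner_commute)
        finally show ?thesis using f a by (simp add: V_def)
      qed
      then show ?thesis using symmetric_onD(1)[OF F(2)[OF T]] f by (auto simp: V_def)
    qed
    ultimately obtain f where f: "f \<in> V" "ip f f \<noteq> 0" "\<And>T. T \<in> F \<Longrightarrow> \<exists>\<mu>. eigenvector T \<mu> f"
      using joint_eigenvector_exists[OF F \<open>lin_sub V\<close>] \<open>v \<in> V\<close> by metis
    have fH: "f \<in> H" and orth: "\<And>a. a < m \<Longrightarrow> ip f (e a) = 0" using f(1) by (auto simp: V_def)
    have pos: "ip f f > 0" using f(2) ip_self_nonneg[of f] by simp
    define g where "g = (\<lambda>x. (1 / sqrt (ip f f)) * f x)"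
    have g: "g \<in> H" "\<And>h. h \<in> H \<Longrightarrow> ip g h = (1 / sqrt (ip f f)) * ip f h"
      unfolding g_def by (rule H_scale[OF fH], rule ip_scale[OF fH])
    have "ip g g = (1 / sqrt (ip f f)) * (1 / sqrt (ip f f)) * ip f f"
      using g fH l2_inner_commute[of M f g] by simp
    then have gg: "ip g g = 1" using pos by (simp add: field_simps)
    have eg: "\<exists>\<mu>. eigenvector T \<mu> g" if T: "T \<in> F" for T
    proof -
      obtain \<mu> where \<mu>: "eigenvector T \<mu> f" using f(3) T by blast
      have "ip (T g) h = \<mu> * ip g h" if h: "h \<in> H" for h
      proof -
        have "ip (T g) h = (1 / sqrt (ip f f)) * ip f (T h)"
          using symmetric_onD[OF F(2)[OF T]] g h by simp
        also have "ip f (T h) = \<mu> * ip f h"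
          using symmetric_onD(2)[OF F(2)[OF T] fH h] \<mu> h by (simp add: eigenvector_def)
        finally show ?thesis using g(2)[OF h] by simp
      qed
      then show ?thesis by (auto simp: eigenvector_def)
    qed
    define e' where "e' = e(m := g)"
    have "ip g (e a) = 0" "ip (e a) g = 0" if "a < m" for a
      using g(2)[OF eH[OF that]] orth[OF that] by (simp_all add: l2_inner_commute)
    then have "orthonormal (Suc m) e'"
      using e(1) g(1) gg unfolding orthonormal_def e'_def by (auto simp: less_Suc_eq)
    moreover have "\<forall>a<Suc m. \<forall>T\<in>F. \<exists>\<mu>. eigenvector T \<mu> (e' a)"
      using e(2) eg by (auto simp: e'_def less_Suc_eq)
    ultimately have "P (Suc m)" by (auto simp: P_def)
    then show False using m(2) by fastforce
  qed
  have "AE x in M. f x = (\<Sum>a<m. ip f (e a) * e a x)" if f: "f \<in> H" for f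
  proof -
    define s where "s = (\<lambda>x. \<Sum>a<m. ip f (e a) * e a x)"
    have s: "s \<in> H" unfolding s_def using eH by (intro H_sum) auto
    have "(\<lambda>x. f x - s x) \<in> V"
      using H_diff[OF f s] ip_diff[OF f s] eH ip_orthonormal_sum[OF e(1)]
      by (auto simp: V_def s_def)
    then show ?thesis
      using null[of "\<lambda>x. f x - s x"] ip_self_eq_0_iff[OF H_diff[OF f s]] by (simp add: s_def)
  qed
  then show ?thesis using e by blast
qed

section \<open>Dimension modulo null functions\<close>

lemma AE_sum_zero:
  assumes "orthonormal m e" "AE x in M. (\<Sum>a<m. c a * e a x) = 0" "b < m"
  shows "c b = 0"
proof -
  have H: "(\<lambda>x. \<Sum>a<m. c a * e a x) \<in> H"
    using orthonormalD(1)[OF assms(1)] by (intro H_sum) auto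
  have "ip (\<lambda>x. \<Sum>a<m. c a * e a x) (e b) = ip (\<lambda>x. 0) (e b)"
    using AE_eq_iff_ip[OF H H_zero] assms orthonormalD(1)[OF assms(1)] by auto
  then show ?thesis using ip_orthonormal_sum[OF assms(1,3), of c] by (simp add: l2_inner_def)
qed

text \<open>The orthonormal system is itself an \<open>ae_basis\<close>, so the choice inside
  \<open>ae_dim\<close> picks a genuine basis, and elimination shows that fewer than m functions
  cannot span m orthonormal ones. The inequality suffices for the final sum, which can be padded
  with zero terms.\<close>

lemma le_ae_dim:
  assumes e: "orthonormal m e"
    and ex: "\<And>f. f \<in> H \<Longrightarrow> AE x in M. f x = (\<Sum>a<m. ip f (e a) * e a x)"
  shows "m \<le> ae_dim M H"
proof -
  have inj: "inj_on e {..<m}"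
  proof (rule inj_onI)
    fix a b assume "a \<in> {..<m}" "b \<in> {..<m}" "e a = e b"
    then show "a = b" using orthonormalD(2)[OF e, of a a] orthonormalD(2)[OF e, of a b]
      by (auto split: if_splits)
  qed
  have "ae_basis M H (e ` {..<m})"
    unfolding ae_basis_def
  proof (intro conjI allI impI ballI)
    show "finite (e ` {..<m})" "e ` {..<m} \<subseteq> H" using orthonormalD(1)[OF e] by auto
  next
    fix c b assume "AE x in M. (\<Sum>b\<in>e ` {..<m}. c b * b x) = 0" "b \<in> e ` {..<m}"
    then show "c b = 0"
      using AE_sum_zero[OF e, of "\<lambda>a. c (e a)"] by (auto simp: sum.reindex[OF inj])
  next
    fix f assume "f \<in> H"
    then show "\<exists>c. AE x in M. f x = (\<Sum>b\<in>e ` {..<m}. c b * b x)"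
      using ex[of f] by (intro exI[of _ "\<lambda>b. ip f b"]) (simp add: sum.reindex[OF inj])
  qed
  moreover define B where "B = (SOME B. ae_basis M H B)"
  ultimately have B: "ae_basis M H B" by (metis someI)
  have "m \<le> card B"
  proof (rule ccontr)
    assume "\<not> m \<le> card B"
    have finB: "finite B" and span: "\<forall>f\<in>H. \<exists>c. AE x in M. f x = (\<Sum>b\<in>B. c b * b x)"
      using B unfolding ae_basis_def by - (elim conjE, assumption)+
    have "\<forall>a<m. \<exists>c. AE x in M. e a x = (\<Sum>b\<in>B. c b * b x)"
      using bspec[OF span] orthonormalD(1)[OF e] by fast
    then obtain c where c: "\<And>a. a < m \<Longrightarrow> AE x in M. e a x = (\<Sum>b\<in>B. c a b * b x)" by metis
    obtain r where r: "\<exists>a<m. r a \<noteq> 0" "\<forall>b\<in>B. (\<Sum>a<m. r a * c a b) = 0"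
      using homogeneous_system_nontrivial_solution[OF finB, of "{..<m}" c] \<open>\<not> m \<le> card B\<close>
      by auto
    have "AE x in M. \<forall>a\<in>{..<m}. e a x = (\<Sum>b\<in>B. c a b * b x)"
      using c by (intro AE_finite_allI) auto
    then have "AE x in M. (\<Sum>a<m. r a * e a x) = 0"
    proof eventually_elim
      case (elim x)
      then have "(\<Sum>a<m. r a * e a x) = (\<Sum>a<m. \<Sum>b\<in>B. r a * c a b * b x)"
        by (intro sum.cong) (auto simp: sum_distrib_left mult.assoc)
      also have "\<dots> = (\<Sum>b\<in>B. (\<Sum>a<m. r a * c a b) * b x)"
        by (subst sum.swap) (simp add: sum_distrib_right)
      finally show ?case using r(2) by simp
    qed
    then show False using AE_sum_zero[OF e] r(1) by blast
  qed
  then show ?thesis by (simp add: ae_dim_def B_def)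
qed

section \<open>Orthogonal projection and compressed multiplication operators\<close>

text \<open>The Fourier sum over an orthonormal basis of \<open>H\<close> has the defining property,
  so the choice is proper. Integrability is asked of the products of q with elements of
  \<open>H\<close>, which is the form in which it is available for a coordinate times an element of
  \<open>H\<close>.\<close>

lemma orth_proj:
  assumes q: "\<And>g. g \<in> H \<Longrightarrow> integrable M (\<lambda>x. q x * g x)"
  shows "orth_proj M H q \<in> H" "g \<in> H \<Longrightarrow> ip (orth_proj M H q) g = ip q g"
proof -
  obtain m e where e: "orthonormal m e"
    and ex: "\<And>f. f \<in> H \<Longrightarrow> AE x in M. f x = (\<Sum>a<m. ip f (e a) * e a x)"
    using joint_eigenbasis_exists[of "{}"] by auto
  have diff: "ip (\<lambda>x. q x - h x) g = ip q g - ip h g" if "h \<in> H" "g \<in> H" for h g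
    unfolding l2_inner_def
    using Bochner_Integration.integral_diff[OF q[OF that(2)] H_integrable[OF that]]
    by (simp add: algebra_simps)
  define p where "p = (\<lambda>x. \<Sum>a<m. ip q (e a) * e a x)"
  have p: "p \<in> H" unfolding p_def using orthonormalD(1)[OF e] by (intro H_sum) auto
  have "ip (\<lambda>x. q x - p x) g = 0" if g: "g \<in> H" for g
  proof -
    define s where "s = (\<lambda>x. \<Sum>a<m. ip g (e a) * e a x)"
    have s: "s \<in> H" unfolding s_def using orthonormalD(1)[OF e] by (intro H_sum) auto
    have gs: "AE x in M. g x = s x" using ex[OF g] by (simp add: s_def)
    have "ip q g = ip q s"
      unfolding l2_inner_def using q[OF g] q[OF s] gs
      by (intro integral_cong_AE) auto
    also have "\<dots> = (LINT x|M. (\<Sum>a<m. ip g (e a) * (q x * e a x)))"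
      unfolding l2_inner_def s_def by (simp add: sum_distrib_left algebra_simps)
    also have "\<dots> = (\<Sum>a<m. ip g (e a) * ip q (e a))"
      unfolding l2_inner_def using q orthonormalD(1)[OF e]
      by (subst Bochner_Integration.integral_sum) auto
    also have "\<dots> = ip p g"
      unfolding p_def using orthonormalD(1)[OF e] g
      by (subst ip_sum) (auto simp: l2_inner_commute[of M g] mult.commute)
    finally show ?thesis using diff[OF p g] by simp
  qed
  then have "\<exists>h. h \<in> H \<and> (\<forall>g\<in>H. ip (\<lambda>x. q x - h x) g = 0)" using p by blast
  then have *: "orth_proj M H q \<in> H \<and> (\<forall>g\<in>H. ip (\<lambda>x. q x - orth_proj M H q x) g = 0)"
    unfolding orth_proj_def by (rule someI_ex)
  then show "orth_proj M H q \<in> H" "g \<in> H \<Longrightarrow> ip (orth_proj M H q) g = ip q g"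
    using diff by auto
qed

text \<open>The inner projection fixes f almost everywhere and the outer one is invisible to test
  functions in \<open>H\<close>. The resulting integral formula yields both the symmetry of the
  compressed coordinates and the location of their joint eigenvalues.\<close>

lemma compressed_multiplier:
  assumes q: "\<And>f g. f \<in> H \<Longrightarrow> g \<in> H \<Longrightarrow> integrable M (\<lambda>x. q x * f x * g x)"
    and f: "f \<in> H"
  defines "Q \<equiv> (\<lambda>f. orth_proj M H (\<lambda>x. q x * orth_proj M H f x))"
  shows "Q f \<in> H" "g \<in> H \<Longrightarrow> ip (Q f) g = (LINT x|M. q x * f x * g x)"
proof -
  note pf = orth_proj[of f, OF H_integrable[OF f]]
  show "Q f \<in> H" unfolding Q_def using orth_proj(1)[OF q[OF pf(1)]] .
  assume g: "g \<in> H"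
  have "AE x in M. orth_proj M H f x = f x"
    using AE_eq_iff_ip[OF pf(1) f] pf(2) by simp
  then have "(LINT x|M. q x * orth_proj M H f x * g x) = (LINT x|M. q x * f x * g x)"
    using q[OF pf(1) g] q[OF f g] by (intro integral_cong_AE) auto
  then show "ip (Q f) g = (LINT x|M. q x * f x * g x)"
    unfolding Q_def using orth_proj(2)[OF q[OF pf(1)] g] by (simp add: l2_inner_def)
qed

section \<open>Positive Weyl words force commutation\<close>

lemma symmetric_on_funpow: "symmetric_on T \<Longrightarrow> symmetric_on (T ^^ k)"
proof (induction k)
  case (Suc k)
  then show ?case using symmetric_onD[OF Suc.prems] symmetric_onD[OF Suc.IH[OF Suc.prems]]
    unfolding symmetric_on_def by (simp add: funpow_swap1)
qed (simp add: symmetric_on_def)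

lemma eigenvector_funpow:
  assumes T: "symmetric_on T" and f: "f \<in> H" "eigenvector T \<mu> f"
  shows "eigenvector (T ^^ k) (\<mu> ^ k) f"
proof (induction k)
  case (Suc k)
  have "ip ((T ^^ Suc k) f) h = \<mu> ^ Suc k * ip f h" if h: "h \<in> H" for h
  proof -
    have "ip ((T ^^ Suc k) f) h = ip ((T ^^ k) f) (T h)"
      using symmetric_onD[OF T] symmetric_onD[OF symmetric_on_funpow[OF T]] f h by simp
    also have "\<dots> = \<mu> ^ k * ip (T f) h"
      using Suc f h symmetric_onD[OF T] by (simp add: eigenvector_def)
    finally show ?thesis using f h by (simp add: eigenvector_def)
  qed
  then show ?case by (simp add: eigenvector_def)
qed (simp add: eigenvector_def)

text \<open>The value of the form at f + t g is a nonnegative quadratic polynomial in t. Since T is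
  not literally linear, symmetry is used to expand it.\<close>

lemma pos_semidef_Cauchy_Schwarz:
  assumes T: "symmetric_on T" "pos_semidef_on M H T" and fg: "f \<in> H" "g \<in> H"
  shows "(ip (T f) g)\<^sup>2 \<le> ip (T f) f * ip (T g) g"
proof -
  define A B C where "A = ip (T f) f" and "B = ip (T f) g" and "C = ip (T g) g"
  have quad: "A + 2 * t * B + t\<^sup>2 * C \<ge> 0" for t
  proof -
    define h where "h = (\<lambda>x. 1 * f x + t * g x)"
    have h: "h \<in> H" unfolding h_def using fg by (rule H_lincomb)
    have Tf: "T f \<in> H" "T g \<in> H" "T h \<in> H" using symmetric_onD(1)[OF T(1)] fg h by auto
    have "0 \<le> ip (T h) h" using T(2) h unfolding pos_semidef_on_def by blast
    also have "ip (T h) h = 1 * ip f (T h) + t * ip g (T h)"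
      using fg Tf unfolding h_def by (subst l2_inner_commute) (rule ip_lincomb)
    also have "ip f (T h) = 1 * ip (T f) f + t * ip (T f) g"
      using symmetric_onD(2)[OF T(1) fg(1) h] ip_lincomb_right[OF fg Tf(1), of 1 t] by (simp add: h_def)
    also have "ip g (T h) = 1 * ip (T g) f + t * ip (T g) g"
      using symmetric_onD(2)[OF T(1) fg(2) h] ip_lincomb_right[OF fg Tf(2), of 1 t] by (simp add: h_def)
    also have "ip (T g) f = ip (T f) g"
      using symmetric_onD(2)[OF T(1) fg] by (simp add: l2_inner_commute)
    finally show ?thesis by (simp add: A_def B_def C_def power2_eq_square algebra_simps)
  qed
  have "C \<ge> 0" using T(2) fg unfolding pos_semidef_on_def C_def by blast
  have "B\<^sup>2 \<le> A * C"
  proof (cases "C = 0")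
    case True
    have "B = 0"
    proof (rule ccontr)
      assume "B \<noteq> 0"
      \<comment> \<open>For C = 0 this t gives the quadratic the value -1.\<close>
      then show False using quad[of "- (A + 1) / (2 * B)"] True by (simp add: field_simps)
    qed
    then show ?thesis using True by simp
  next
    case False
    then have "C > 0" using \<open>C \<ge> 0\<close> by simp
    then have "0 \<le> (A + 2 * (- B / C) * B + (- B / C)\<^sup>2 * C) * C" using quad[of "- B / C"] by simp
    also have "\<dots> = A * C - B\<^sup>2" using \<open>C > 0\<close> by (simp add: field_simps power2_eq_square)
    finally show ?thesis by simp
  qed
  then show ?thesis by (simp add: A_def B_def C_def)
qed

lemma symmetric_on_weyl_word:
  assumes "symmetric_on X" "symmetric_on Y" "pos_semidef_on M H (weyl_word k X Y)"
  shows "symmetric_on (weyl_word k X Y)"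
proof -
  have "weyl_word k X Y f \<in> H" if f: "f \<in> H" for f
  proof -
    have "((X ^^ (k - j)) \<circ> Y \<circ> (X ^^ j)) f \<in> H" for j
      using symmetric_onD(1)[OF symmetric_on_funpow[OF assms(1)]] symmetric_onD(1)[OF assms(2)] f by simp
    then show ?thesis
      using H_sum[of "{..k}" "\<lambda>j. ((X ^^ (k - j)) \<circ> Y \<circ> (X ^^ j)) f" "\<lambda>_. 1"]
      by (simp add: weyl_word_def)
  qed
  then show ?thesis using assms(3) by (simp add: symmetric_on_def pos_semidef_on_def)
qed

text \<open>In an eigenbasis of X the word multiplies each entry of Y by the complete homogeneous
  polynomial of degree k in the two eigenvalues.\<close>

lemma ip_weyl_word_eigenvectors:
  assumes X: "symmetric_on X" and Y: "symmetric_on Y"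
    and f: "f \<in> H" "eigenvector X \<mu> f" and g: "g \<in> H" "eigenvector X \<nu> g"
  shows "ip (weyl_word k X Y f) g = (\<Sum>j\<le>k. \<nu> ^ (k - j) * \<mu> ^ j) * ip (Y f) g"
proof -
  note Xk = symmetric_onD[OF symmetric_on_funpow[OF X]] and Y' = symmetric_onD[OF Y]
  have in_H: "(X ^^ (k - j)) (Y ((X ^^ j) f)) \<in> H" for j using Xk(1) Y'(1) f by simp
  have "ip (weyl_word k X Y f) g =
      ip (\<lambda>x. \<Sum>j\<le>k. 1 * ((X ^^ (k - j)) (Y ((X ^^ j) f))) x) g"
    by (simp add: weyl_word_def)
  also have "\<dots> = (\<Sum>j\<le>k. 1 * ip ((X ^^ (k - j)) (Y ((X ^^ j) f))) g)"
    using in_H g by (intro ip_sum) auto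
  also have "\<dots> = (\<Sum>j\<le>k. \<nu> ^ (k - j) * \<mu> ^ j * ip (Y f) g)"
  proof (rule sum.cong)
    fix j
    have YX: "Y ((X ^^ j) f) \<in> H" using Xk(1) Y'(1) f by simp
    have "ip ((X ^^ (k - j)) (Y ((X ^^ j) f))) g = ip ((X ^^ (k - j)) g) (Y ((X ^^ j) f))"
      using Xk(2)[OF YX g(1)] by (simp add: l2_inner_commute)
    also have "\<dots> = \<nu> ^ (k - j) * ip g (Y ((X ^^ j) f))"
      using eigenvector_funpow[OF X g] YX by (simp add: eigenvector_def)
    also have "ip g (Y ((X ^^ j) f)) = ip ((X ^^ j) f) (Y g)"
      using Y'(2)[OF g(1) Xk(1)[OF f(1), of j]] by (simp add: l2_inner_commute)
    also have "\<dots> = \<mu> ^ j * ip f (Y g)"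
      using eigenvector_funpow[OF X f] Y'(1)[OF g(1)] by (simp add: eigenvector_def)
    also have "ip f (Y g) = ip (Y f) g" using Y'(2)[OF f(1) g(1)] by simp
    finally show "1 * ip ((X ^^ (k - j)) (Y ((X ^^ j) f))) g = \<nu> ^ (k - j) * \<mu> ^ j * ip (Y f) g"
      by simp
  qed auto
  finally show ?thesis by (simp add: sum_distrib_right)
qed

text \<open>In an eigenbasis of \<open>X\<close> with eigenvalues \<open>\<mu> > \<nu> \<ge> 0\<close>, the two by two minors of the
  \<open>k\<close>-th word bound the squared entry of \<open>Y\<close> by a multiple of \<open>(k + 1)\<^sup>2 (\<nu> / \<mu>)\<^sup>k\<close>.\<close>

lemma weyl_words_psd_imp_orthogonal:
  assumes X: "symmetric_on X" and Y: "symmetric_on Y"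
    and psd: "\<And>k. k \<ge> 1 \<Longrightarrow> pos_semidef_on M H (weyl_word k X Y)"
    and f: "f \<in> H" "eigenvector X \<mu> f" and g: "g \<in> H" "eigenvector X \<nu> g"
    and \<mu>\<nu>: "0 \<le> \<nu>" "\<nu> < \<mu>"
  shows "ip (Y f) g = 0"
proof -
  define y where "y = ip (Y f) g"
  define D where "D = ip (Y f) f * ip (Y g) g"
  \<comment> \<open>The square root makes the bound the square of (k+1) s^k, which tends to 0
    because s < 1.\<close>
  define s where "s = sqrt (\<nu> / \<mu>)"
  have s: "0 \<le> s" "s < 1" "s\<^sup>2 = \<nu> / \<mu>" using \<mu>\<nu> by (auto simp: s_def)
  have bound: "y\<^sup>2 \<le> ((real k + 1) * s ^ k)\<^sup>2 * D" if k: "k \<ge> 1" for k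
  proof -
    define S where "S = (\<Sum>j\<le>k. \<nu> ^ (k - j) * \<mu> ^ j)"
    \<comment> \<open>The term j = k alone is a lower bound, since the other terms are
      nonnegative.\<close>
    have "\<mu> ^ k = (\<Sum>j\<in>{k}. \<nu> ^ (k - j) * \<mu> ^ j)" by simp
    also have "\<dots> \<le> S" unfolding S_def using \<mu>\<nu> by (intro sum_mono2) auto
    finally have S: "\<mu> ^ k \<le> S" .
    have diag: "(\<Sum>j\<le>k. t ^ (k - j) * t ^ j) = (real k + 1) * t ^ k" for t :: real
    proof -
      have "(\<Sum>j\<le>k. t ^ (k - j) * t ^ j) = (\<Sum>j\<le>k. t ^ k)"
        by (intro sum.cong) (auto simp flip: power_add)
      then show ?thesis by simp
    qed
    have "(\<mu> ^ k)\<^sup>2 * y\<^sup>2 \<le> S\<^sup>2 * y\<^sup>2"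
      using S \<mu>\<nu> by (intro mult_right_mono power_mono) auto
    also have "S\<^sup>2 * y\<^sup>2 = (ip (weyl_word k X Y f) g)\<^sup>2"
      by (simp add: ip_weyl_word_eigenvectors[OF X Y f g] S_def y_def power_mult_distrib)
    also have "\<dots> \<le> ip (weyl_word k X Y f) f * ip (weyl_word k X Y g) g"
      using psd[OF k] symmetric_on_weyl_word[OF X Y] f g
      by (intro pos_semidef_Cauchy_Schwarz) auto
    also have "\<dots> = (real k + 1)\<^sup>2 * (\<mu> ^ k * \<nu> ^ k) * D"
      by (simp add: ip_weyl_word_eigenvectors[OF X Y f f] ip_weyl_word_eigenvectors[OF X Y g g]
          diag D_def power2_eq_square)
    also have "\<nu> ^ k = \<mu> ^ k * (s ^ k)\<^sup>2"
    proof -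
      have "\<nu> = \<mu> * s\<^sup>2" using \<mu>\<nu> s(3) by simp
      then show ?thesis by (simp add: power_mult_distrib mult.commute flip: power_mult)
    qed
    finally have "(\<mu> ^ k)\<^sup>2 * y\<^sup>2 \<le> (\<mu> ^ k)\<^sup>2 * (((real k + 1) * s ^ k)\<^sup>2 * D)"
      by (simp add: power_mult_distrib algebra_simps power2_eq_square)
    moreover have "(\<mu> ^ k)\<^sup>2 > 0" using \<mu>\<nu> by simp
    ultimately show ?thesis by (simp only: mult_le_cancel_left_pos)
  qed
  have "(\<lambda>k. real k * s ^ k) \<longlonglongrightarrow> 0" "(\<lambda>k. s ^ k) \<longlonglongrightarrow> 0"
    using s powser_times_n_limit_0[of s] by (auto intro: LIMSEQ_power_zero)
  from tendsto_add[OF this] have "(\<lambda>k. (real k + 1) * s ^ k) \<longlonglongrightarrow> 0"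
    by (simp add: algebra_simps)
  from tendsto_mult_right[OF tendsto_power[OF this, of 2], of D]
  have "(\<lambda>k. ((real k + 1) * s ^ k)\<^sup>2 * D) \<longlonglongrightarrow> 0" by simp
  then have "y\<^sup>2 \<le> 0" using bound by (intro LIMSEQ_le_const) auto
  then show ?thesis by (simp add: y_def)
qed

lemma ip_expand:
  assumes e: "orthonormal m e"
    and ex: "\<And>f. f \<in> H \<Longrightarrow> AE x in M. f x = (\<Sum>a<m. ip f (e a) * e a x)"
    and f: "f \<in> H" "h \<in> H"
  shows "ip f h = (\<Sum>a<m. ip f (e a) * ip (e a) h)"
proof -
  have s: "(\<lambda>x. \<Sum>a<m. ip f (e a) * e a x) \<in> H"
    using orthonormalD(1)[OF e] by (intro H_sum) auto
  then have "ip f h = ip (\<lambda>x. \<Sum>a<m. ip f (e a) * e a x) h"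
    using AE_eq_iff_ip[OF f(1) s] ex[OF f(1)] f(2) by blast
  also have "\<dots> = (\<Sum>a<m. ip f (e a) * ip (e a) h)"
    using orthonormalD(1)[OF e] f(2) by (intro ip_sum) auto
  finally show ?thesis .
qed

text \<open>In an eigenbasis of X the entries of the two products are those of Y times \<mu> a and
  \<mu> b respectively; they agree because the entry of Y is zero whenever these eigenvalues
  differ.\<close>

lemma weyl_words_psd_imp_commute:
  assumes X: "symmetric_on X" and Y: "symmetric_on Y" and Xpos: "pos_semidef_on M H X"
    and psd: "\<And>k. k \<ge> 1 \<Longrightarrow> pos_semidef_on M H (weyl_word k X Y)"
  shows "commute_on X Y"
proof -
  have "\<And>S T. S \<in> {X} \<Longrightarrow> T \<in> {X} \<Longrightarrow> commute_on S T"
    by (simp add: commute_on_def)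
  then obtain m e where e: "orthonormal m e" and eig: "\<forall>a<m. \<exists>\<mu>. eigenvector X \<mu> (e a)"
    and ex: "\<And>f. f \<in> H \<Longrightarrow> AE x in M. f x = (\<Sum>a<m. ip f (e a) * e a x)"
    using joint_eigenbasis_exists[of "{X}"] X by auto
  obtain \<mu> where \<mu>: "\<And>a. a < m \<Longrightarrow> eigenvector X (\<mu> a) (e a)" using eig by metis
  note eH = orthonormalD(1)[OF e] and X' = symmetric_onD[OF X] and Y' = symmetric_onD[OF Y]
  have \<mu>_nonneg: "\<mu> a \<ge> 0" if a: "a < m" for a
  proof -
    have "0 \<le> ip (X (e a)) (e a)" using Xpos eH[OF a] unfolding pos_semidef_on_def by blast
    then show ?thesis using \<mu>[OF a] eH[OF a] orthonormalD(2)[OF e a a] by (simp add: eigenvector_def)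
  qed
  have basis: "ip (X (e a)) (Y (e b)) = ip (Y (e a)) (X (e b))" if ab: "a < m" "b < m" for a b
  proof -
    have "ip (X (e a)) (Y (e b)) = \<mu> a * ip (Y (e a)) (e b)"
      using \<mu>[OF ab(1)] Y' eH ab by (simp add: eigenvector_def)
    moreover have "ip (Y (e a)) (X (e b)) = \<mu> b * ip (Y (e a)) (e b)"
      using \<mu>[OF ab(2)] Y'(1) eH ab l2_inner_commute[of M "Y (e a)"] by (simp add: eigenvector_def)
    \<comment> \<open>The orthogonality lemma wants the larger eigenvalue first; symmetry of Y
      covers the other order.\<close>
    moreover have "\<mu> a = \<mu> b \<or> ip (Y (e a)) (e b) = 0"
    proof -
      have "ip (Y (e b)) (e a) = ip (Y (e a)) (e b)"
        using Y'(2)[OF eH[OF ab(1)] eH[OF ab(2)]] by (simp add: l2_inner_commute)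
      then show ?thesis
        using weyl_words_psd_imp_orthogonal[OF X Y psd eH[OF ab(1)] \<mu>[OF ab(1)] eH[OF ab(2)] \<mu>[OF ab(2)]]
          weyl_words_psd_imp_orthogonal[OF X Y psd eH[OF ab(2)] \<mu>[OF ab(2)] eH[OF ab(1)] \<mu>[OF ab(1)]]
          \<mu>_nonneg ab by (metis linorder_neqE_linordered_idom)
    qed
    ultimately show ?thesis by auto
  qed
  \<comment> \<open>Symmetry is used to free f, and then g, from the operators before each is
    expanded, because the operators are not literally linear.\<close>
  have expand: "ip (S f) (T g) = (\<Sum>a<m. \<Sum>b<m. ip f (e a) * ip g (e b) * ip (S (e a)) (T (e b)))"
    if S: "symmetric_on S" and T: "symmetric_on T" and fg: "f \<in> H" "g \<in> H" for S T f g
  proof -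
    note S' = symmetric_onD[OF S] and T' = symmetric_onD[OF T]
    have "ip (S f) (T g) = ip f (S (T g))" using S' T' fg by simp
    also have "\<dots> = (\<Sum>a<m. ip f (e a) * ip (e a) (S (T g)))"
      using S' T' fg by (intro ip_expand[OF e ex]) auto
    also have "\<dots> = (\<Sum>a<m. ip f (e a) * (\<Sum>b<m. ip g (e b) * ip (S (e a)) (T (e b))))"
    proof (intro sum.cong refl arg_cong[where f = "\<lambda>t. _ * t"])
      fix a assume "a \<in> {..<m}"
      then have a: "a < m" by simp
      have "ip (e a) (S (T g)) = ip g (T (S (e a)))"
        using S'(1)[OF eH[OF a]] S'(2)[OF eH[OF a] T'(1)[OF fg(2)]] T'(2)[of g "S (e a)"] fg(2)
          l2_inner_commute[of M "T g" "S (e a)"] by simp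
      also have "\<dots> = (\<Sum>b<m. ip g (e b) * ip (e b) (T (S (e a))))"
        using S' T' fg eH[OF a] by (intro ip_expand[OF e ex]) auto
      also have "\<dots> = (\<Sum>b<m. ip g (e b) * ip (S (e a)) (T (e b)))"
        using S' T' eH a by (intro sum.cong) (auto simp: l2_inner_commute)
      finally show "ip (e a) (S (T g)) = (\<Sum>b<m. ip g (e b) * ip (S (e a)) (T (e b)))" .
    qed
    finally show ?thesis by (simp add: sum_distrib_left mult.assoc)
  qed
  show ?thesis
    unfolding commute_on_def using expand[OF X Y] expand[OF Y X] basis by simp
qed

section \<open>Complexification and the operator exponential in an eigenbasis\<close>

lemma eigenbasis_expand:
  assumes T: "symmetric_on T" and e: "orthonormal m e"
    and eig: "\<And>a. a < m \<Longrightarrow> eigenvector T (\<theta> a) (e a)"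
    and f: "f \<in> H" "AE x in M. f x = (\<Sum>a<m. r a * e a x)"
  shows "AE x in M. T f x = (\<Sum>a<m. r a * \<theta> a * e a x)"
proof -
  note eH = orthonormalD(1)[OF e] and T' = symmetric_onD[OF T]
  have s: "(\<lambda>x. \<Sum>a<m. c a * e a x) \<in> H" for c using eH by (intro H_sum) auto
  have "ip (T f) h = ip (\<lambda>x. \<Sum>a<m. r a * \<theta> a * e a x) h" if h: "h \<in> H" for h
  proof -
    have "ip (T f) h = ip f (T h)" using T' f(1) h by simp
    also have "\<dots> = ip (\<lambda>x. \<Sum>a<m. r a * e a x) (T h)"
      using AE_eq_iff_ip[OF f(1) s] f(2) T'(1)[OF h] by blast
    also have "\<dots> = (\<Sum>a<m. r a * ip (e a) (T h))"
      using eH T'(1)[OF h] by (intro ip_sum) auto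
    also have "\<dots> = (\<Sum>a<m. r a * \<theta> a * ip (e a) h)"
    proof (intro sum.cong refl)
      fix a assume "a \<in> {..<m}"
      then have a: "a < m" by simp
      have "ip (e a) (T h) = \<theta> a * ip (e a) h"
        using T'(2)[OF eH[OF a] h] eig[OF a] h by (simp add: eigenvector_def)
      then show "r a * ip (e a) (T h) = r a * \<theta> a * ip (e a) h" by simp
    qed
    also have "\<dots> = ip (\<lambda>x. \<Sum>a<m. r a * \<theta> a * e a x) h"
      using eH h by (intro ip_sum[symmetric]) auto
    finally show ?thesis .
  qed
  then show ?thesis using AE_eq_iff_ip[OF T'(1)[OF f(1)] s, of "\<lambda>a. r a * \<theta> a"] by simp
qed

lemma complexify_op_eigenbasis_expand:
  assumes T: "symmetric_on T" and e: "orthonormal m e"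
    and eig: "\<And>a. a < m \<Longrightarrow> eigenvector T (\<theta> a) (e a)"
    and f: "f \<in> complexify_space H" "AE x in M. f x = (\<Sum>a<m. c a * of_real (e a x))"
  shows "AE x in M. complexify_op T f x = (\<Sum>a<m. c a * of_real (\<theta> a) * of_real (e a x))"
proof -
  have "AE x in M. Re (f x) = (\<Sum>a<m. Re (c a) * e a x)"
    using f(2) by eventually_elim simp
  then have 1: "AE x in M. T (\<lambda>x. Re (f x)) x = (\<Sum>a<m. Re (c a) * \<theta> a * e a x)"
    using f(1) by (intro eigenbasis_expand[OF T e eig]) (auto simp: complexify_space_def)
  have "AE x in M. Im (f x) = (\<Sum>a<m. Im (c a) * e a x)"
    using f(2) by eventually_elim simp
  then have 2: "AE x in M. T (\<lambda>x. Im (f x)) x = (\<Sum>a<m. Im (c a) * \<theta> a * e a x)"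
    using f(1) by (intro eigenbasis_expand[OF T e eig]) (auto simp: complexify_space_def)
  from 1 2 show ?thesis
    by eventually_elim (simp add: complexify_op_def complex_eq_iff)
qed

lemma pencil_c_in_complexify_space:
  fixes A :: "'d::finite \<Rightarrow> ('a \<Rightarrow> real) \<Rightarrow> 'a \<Rightarrow> real"
  assumes A: "\<And>j. symmetric_on (A j)" and f: "f \<in> complexify_space H"
  shows "pencil_c A w f \<in> complexify_space H"
proof -
  have AH: "A j (\<lambda>x. Re (f x)) \<in> H" "A j (\<lambda>x. Im (f x)) \<in> H" for j
    using f symmetric_onD(1)[OF A] by (auto simp: complexify_space_def)
  have "(\<lambda>x. \<Sum>j\<in>UNIV. 1 * (Re (w $ j) * A j (\<lambda>x. Re (f x)) x
      + (- Im (w $ j)) * A j (\<lambda>x. Im (f x)) x)) \<in> H"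
    by (rule H_sum, simp) (rule H_lincomb[OF AH(1) AH(2)])
  moreover have "(\<lambda>x. \<Sum>j\<in>UNIV. 1 * (Re (w $ j) * A j (\<lambda>x. Im (f x)) x
      + Im (w $ j) * A j (\<lambda>x. Re (f x)) x)) \<in> H"
    by (rule H_sum, simp) (rule H_lincomb[OF AH(2) AH(1)])
  ultimately show ?thesis
    by (simp add: complexify_space_def pencil_c_def complexify_op_def)
qed

lemma pencil_c_eigenbasis_expand:
  fixes A :: "'d::finite \<Rightarrow> ('a \<Rightarrow> real) \<Rightarrow> 'a \<Rightarrow> real"
  assumes A: "\<And>j. symmetric_on (A j)" and e: "orthonormal m e"
    and eig: "\<And>a j. a < m \<Longrightarrow> eigenvector (A j) (\<Lambda> a $ j) (e a)"
    and f: "f \<in> complexify_space H" "AE x in M. f x = (\<Sum>a<m. c a * of_real (e a x))"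
  shows "AE x in M. pencil_c A w f x =
    (\<Sum>a<m. c a * (\<Sum>j\<in>UNIV. w $ j * of_real (\<Lambda> a $ j)) * of_real (e a x))"
proof -
  have "AE x in M. \<forall>j\<in>UNIV. complexify_op (A j) f x =
      (\<Sum>a<m. c a * of_real (\<Lambda> a $ j) * of_real (e a x))"
    using complexify_op_eigenbasis_expand[OF A e _ f] eig by (intro AE_finite_allI) auto
  then show ?thesis
  proof eventually_elim
    case (elim x)
    then have "pencil_c A w f x =
        (\<Sum>j\<in>UNIV. \<Sum>a<m. c a * (w $ j * of_real (\<Lambda> a $ j)) * of_real (e a x))"
      unfolding pencil_c_def by (intro sum.cong) (auto simp: sum_distrib_left mult_ac)
    then show ?case
      by (subst (asm) sum.swap) (simp add: sum_distrib_left sum_distrib_right)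
  qed
qed

lemma complexify_space_sum:
  assumes "finite K" "\<And>k. k \<in> K \<Longrightarrow> f k \<in> complexify_space H"
  shows "(\<lambda>x. \<Sum>k\<in>K. f k x * of_real (c k)) \<in> complexify_space H"
  using assms H_sum[of K "\<lambda>k x. Re (f k x)" c] H_sum[of K "\<lambda>k x. Im (f k x)" c]
  by (simp add: complexify_space_def mult.commute)

lemma integrable_cmod_square:
  assumes "f \<in> complexify_space H"
  shows "integrable M (\<lambda>x. (cmod (f x))\<^sup>2)"
proof -
  have "integrable M (\<lambda>x. Re (f x) * Re (f x) + Im (f x) * Im (f x))"
    using assms by (intro Bochner_Integration.integrable_add H_integrable)
      (auto simp: complexify_space_def)
  then show ?thesis by (simp add: cmod_power2 flip: power2_eq_square)
qed

lemma measurable_complexify_space: "f \<in> complexify_space H \<Longrightarrow> f \<in> borel_measurable M"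
  using H_measurable by (subst borel_measurable_complex_iff) (auto simp: complexify_space_def)

lemma complexify_space_diff:
  "f \<in> complexify_space H \<Longrightarrow> g \<in> complexify_space H \<Longrightarrow> (\<lambda>x. f x - g x) \<in> complexify_space H"
  using H_diff by (simp add: complexify_space_def)

lemma complexify_space_orthonormal_sum:
  assumes "orthonormal m e"
  shows "(\<lambda>x. \<Sum>a<m. c a * of_real (e a x)) \<in> complexify_space H"
  using orthonormalD(1)[OF assms] H_sum[of "{..<m}" e]
  by (simp add: complexify_space_def)

text \<open>The \<open>e a\<close> are real valued, so the real and imaginary parts separate and the
  real identity applies to each.\<close>

lemma Parseval_complex:
  assumes e: "orthonormal m e"
  shows "(LINT x|M. (cmod (\<Sum>a<m. c a * of_real (e a x)))\<^sup>2) = (\<Sum>a<m. (cmod (c a))\<^sup>2)"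
proof -
  note eH = orthonormalD(1)[OF e]
  have sH: "(\<lambda>x. \<Sum>a<m. r a * e a x) \<in> H" for r using eH by (intro H_sum) auto
  have norm: "ip (\<lambda>x. \<Sum>a<m. r a * e a x) (\<lambda>x. \<Sum>a<m. r a * e a x) = (\<Sum>a<m. (r a)\<^sup>2)" for r
  proof -
    have "ip (\<lambda>x. \<Sum>a<m. r a * e a x) (\<lambda>x. \<Sum>a<m. r a * e a x)
        = (\<Sum>a<m. r a * ip (e a) (\<lambda>x. \<Sum>a<m. r a * e a x))"
      using eH sH by (intro ip_sum) auto
    also have "\<dots> = (\<Sum>a<m. (r a)\<^sup>2)"
      using ip_orthonormal_sum[OF e, of _ r]
      by (intro sum.cong) (auto simp: l2_inner_commute[of M "e _"] power2_eq_square)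
    finally show ?thesis .
  qed
  have "(LINT x|M. (cmod (\<Sum>a<m. c a * of_real (e a x)))\<^sup>2) =
      (LINT x|M. (\<Sum>a<m. Re (c a) * e a x) * (\<Sum>a<m. Re (c a) * e a x)
        + (\<Sum>a<m. Im (c a) * e a x) * (\<Sum>a<m. Im (c a) * e a x))"
    by (simp add: cmod_power2 flip: power2_eq_square)
  also have "\<dots> = (\<Sum>a<m. (Re (c a))\<^sup>2) + (\<Sum>a<m. (Im (c a))\<^sup>2)"
    using Bochner_Integration.integral_add[OF H_integrable[OF sH sH] H_integrable[OF sH sH],
        of "\<lambda>a. Re (c a)" "\<lambda>a. Re (c a)" "\<lambda>a. Im (c a)" "\<lambda>a. Im (c a)"]
      norm[unfolded l2_inner_def] by simp
  finally show ?thesis by (simp add: sum.distrib cmod_power2)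
qed

text \<open>Uniqueness of limits in L2, by the triangle inequality and (r + t)^2 \<le> 2 r^2 + 2
  t^2. It makes the function chosen by \<open>op_exp\<close> computable.\<close>

lemma AE_eq_of_common_limit:
  assumes S: "\<And>k. S k \<in> complexify_space H" and g: "g \<in> complexify_space H" and h: "h \<in> complexify_space H"
    and lim: "(\<lambda>k. LINT x|M. (cmod (S k x - g x))\<^sup>2) \<longlonglongrightarrow> 0"
      "(\<lambda>k. LINT x|M. (cmod (S k x - h x))\<^sup>2) \<longlonglongrightarrow> 0"
  shows "AE x in M. g x = h x"
proof -
  have int: "integrable M (\<lambda>x. (cmod (f x - f' x))\<^sup>2)"
    if "f \<in> complexify_space H" "f' \<in> complexify_space H" for f f'
    using integrable_cmod_square[OF complexify_space_diff[OF that]] .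
  have le: "(LINT x|M. (cmod (g x - h x))\<^sup>2) \<le>
      2 * (LINT x|M. (cmod (S k x - g x))\<^sup>2) + 2 * (LINT x|M. (cmod (S k x - h x))\<^sup>2)" for k
  proof -
    have "(cmod (g x - h x))\<^sup>2 \<le> 2 * (cmod (S k x - g x))\<^sup>2 + 2 * (cmod (S k x - h x))\<^sup>2" for x
    proof -
      have "cmod (g x - h x) \<le> cmod (S k x - g x) + cmod (S k x - h x)"
        using norm_triangle_ineq4[of "S k x - h x" "S k x - g x"] by simp
      then have "(cmod (g x - h x))\<^sup>2 \<le> (cmod (S k x - g x) + cmod (S k x - h x))\<^sup>2"
        by (rule power_mono) simp
      also have "\<dots> \<le> 2 * (cmod (S k x - g x))\<^sup>2 + 2 * (cmod (S k x - h x))\<^sup>2"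
        using sum_squares_bound[of "cmod (S k x - g x)" "cmod (S k x - h x)"]
        by (simp add: power2_sum)
      finally show ?thesis .
    qed
    then have "(LINT x|M. (cmod (g x - h x))\<^sup>2) \<le>
        (LINT x|M. 2 * (cmod (S k x - g x))\<^sup>2 + 2 * (cmod (S k x - h x))\<^sup>2)"
      using int[OF g h] int[OF S g] int[OF S h] by (intro integral_mono) auto
    then show ?thesis using int[OF S g] int[OF S h] by simp
  qed
  have "(\<lambda>k. 2 * (LINT x|M. (cmod (S k x - g x))\<^sup>2) + 2 * (LINT x|M. (cmod (S k x - h x))\<^sup>2)) \<longlonglongrightarrow> 2 * 0 + 2 * 0"
    by (intro tendsto_intros lim)
  then have "(LINT x|M. (cmod (g x - h x))\<^sup>2) \<le> 0"
    using le by (intro LIMSEQ_le_const) auto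
  then have "(LINT x|M. (cmod (g x - h x))\<^sup>2) = 0"
    by (intro antisym integral_nonneg_AE) auto
  then show ?thesis using integral_nonneg_eq_0_iff_AE[OF int[OF g h]] by simp
qed

text \<open>T is diagonal in the basis \<open>e\<close> modulo null functions, so Parseval reduces
  the L2 convergence of its exponential series to finitely many scalar series, one for each complex
  eigenvalue \<theta> a.\<close>

lemma l2_inner_op_exp:
  assumes e: "orthonormal m e"
    and ex: "\<And>f. f \<in> H \<Longrightarrow> AE x in M. f x = (\<Sum>a<m. ip f (e a) * e a x)"
    and T: "\<And>f. f \<in> complexify_space H \<Longrightarrow> T f \<in> complexify_space H"
    and diag: "\<And>f c. f \<in> complexify_space H \<Longrightarrow> AE x in M. f x = (\<Sum>a<m. c a * of_real (e a x)) \<Longrightarrow>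
      AE x in M. T f x = (\<Sum>a<m. c a * \<theta> a * of_real (e a x))"
    and u: "u \<in> H"
  shows "l2_inner_c M (op_exp M (complexify_space H) T (\<lambda>x. of_real (u x))) (\<lambda>x. of_real (u x))
    = (\<Sum>a<m. of_real ((ip u (e a))\<^sup>2) * exp (\<theta> a))"
proof -
  define U where "U = (\<lambda>x. complex_of_real (u x))"
  define c where "c a = complex_of_real (ip u (e a))" for a
  define S where "S N = (\<lambda>x. \<Sum>k<N. (T ^^ k) U x / fact k)" for N
  define E where "E = (\<lambda>x. \<Sum>a<m. c a * exp (\<theta> a) * of_real (e a x))"
  have U: "U \<in> complexify_space H" using u H_zero by (simp add: U_def complexify_space_def)
  have TU: "(T ^^ k) U \<in> complexify_space H" for k by (induction k) (auto intro: T U)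
  have TU_AE: "AE x in M. (T ^^ k) U x = (\<Sum>a<m. c a * \<theta> a ^ k * of_real (e a x))" for k
  proof (induction k)
    case 0
    show ?case using ex[OF u] by eventually_elim (simp add: U_def c_def)
  next
    case (Suc k)
    then show ?case using diag[OF TU, of k "\<lambda>a. c a * \<theta> a ^ k"] by (simp add: mult_ac)
  qed
  have S: "S N \<in> complexify_space H" for N
    using complexify_space_sum[of "{..<N}" "\<lambda>k. (T ^^ k) U" "\<lambda>k. 1 / fact k"] TU
    by (simp add: S_def)
  have E: "E \<in> complexify_space H"
    unfolding E_def by (rule complexify_space_orthonormal_sum[OF e])
  \<comment> \<open>Coordinates of the error \<open>S N - E\<close>.\<close>
  define d where "d N a = c a * ((\<Sum>k<N. \<theta> a ^ k / fact k) - exp (\<theta> a))" for N a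
  have SE: "(LINT x|M. (cmod (S N x - E x))\<^sup>2) = (\<Sum>a<m. (cmod (d N a))\<^sup>2)" for N
  proof -
    have "AE x in M. \<forall>k\<in>{..<N}. (T ^^ k) U x = (\<Sum>a<m. c a * \<theta> a ^ k * of_real (e a x))"
      using TU_AE by (intro AE_finite_allI) auto
    then have ae: "AE x in M. S N x - E x = (\<Sum>a<m. d N a * of_real (e a x))"
    proof eventually_elim
      case (elim x)
      then have "S N x = (\<Sum>k<N. \<Sum>a<m. c a * (\<theta> a ^ k / fact k) * of_real (e a x))"
        unfolding S_def by (intro sum.cong) (auto simp: sum_divide_distrib)
      also have "\<dots> = (\<Sum>a<m. c a * (\<Sum>k<N. \<theta> a ^ k / fact k) * of_real (e a x))"
        by (subst sum.swap) (simp add: sum_distrib_left sum_distrib_right)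
      finally show ?case by (simp add: E_def d_def algebra_simps sum_subtractf)
    qed
    have m1: "(\<lambda>x. S N x - E x) \<in> borel_measurable M"
      using measurable_complexify_space[OF complexify_space_diff[OF S E]] .
    have m2: "(\<lambda>x. \<Sum>a<m. d N a * of_real (e a x)) \<in> borel_measurable M"
      using measurable_complexify_space[OF complexify_space_orthonormal_sum[OF e]] .
    have "(LINT x|M. (cmod (S N x - E x))\<^sup>2) = (LINT x|M. (cmod (\<Sum>a<m. d N a * of_real (e a x)))\<^sup>2)"
      using m1 m2 ae by (intro integral_cong_AE) auto
    then show ?thesis using Parseval_complex[OF e] by simp
  qed
  have "(\<lambda>N. d N a) \<longlonglongrightarrow> c a * (exp (\<theta> a) - exp (\<theta> a))" for a
  proof -
    have "(\<lambda>k. \<theta> a ^ k / fact k) sums exp (\<theta> a)"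
      using exp_converges[of "\<theta> a"] by (simp add: scaleR_conv_of_real divide_inverse mult.commute)
    then show ?thesis unfolding d_def sums_def by (intro tendsto_intros)
  qed
  then have "(\<lambda>N. \<Sum>a<m. (cmod (d N a))\<^sup>2) \<longlonglongrightarrow> (\<Sum>a<m. (cmod (c a * (exp (\<theta> a) - exp (\<theta> a))))\<^sup>2)"
    by (intro tendsto_intros)
  then have limE: "(\<lambda>N. LINT x|M. (cmod (S N x - E x))\<^sup>2) \<longlonglongrightarrow> 0" by (simp add: SE)
  define g where "g = op_exp M (complexify_space H) T U"
  have g_eq: "g = (SOME g. g \<in> complexify_space H \<and>
      (\<lambda>N. LINT x|M. (cmod (S N x - g x))\<^sup>2) \<longlonglongrightarrow> 0)"
    by (simp add: g_def op_exp_def S_def)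
  \<comment> \<open>\<open>E\<close> shows that the choice in \<open>op_exp\<close> is proper;
    uniqueness of the limit then identifies the chosen function with \<open>E\<close> almost
    everywhere.\<close>
  have "\<exists>g. g \<in> complexify_space H \<and> (\<lambda>N. LINT x|M. (cmod (S N x - g x))\<^sup>2) \<longlonglongrightarrow> 0"
    by (intro exI[of _ E] conjI E limE)
  from someI_ex[OF this, folded g_eq]
  have g: "g \<in> complexify_space H" and limg: "(\<lambda>N. LINT x|M. (cmod (S N x - g x))\<^sup>2) \<longlonglongrightarrow> 0"
    by (rule conjunct1, rule conjunct2)
  have gE: "AE x in M. g x = E x" by (rule AE_eq_of_common_limit[OF S g E limg limE])
  have "l2_inner_c M g U = (LINT x|M. g x * U x)"
    by (simp add: l2_inner_c_def U_def)
  also have "\<dots> = (LINT x|M. E x * U x)"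
    using gE measurable_complexify_space[OF g] measurable_complexify_space[OF E]
      measurable_complexify_space[OF U]
    by (intro integral_cong_AE) auto
  also have "\<dots> = (LINT x|M. (\<Sum>a<m. c a * exp (\<theta> a) * of_real (e a x * u x)))"
    by (simp add: E_def U_def sum_distrib_right mult.assoc)
  also have "\<dots> = (\<Sum>a<m. c a * exp (\<theta> a) * of_real (ip (e a) u))"
    unfolding l2_inner_def using H_integrable[OF orthonormalD(1)[OF e] u]
    by (subst Bochner_Integration.integral_sum)
      (auto simp del: of_real_mult intro!: integrable_mult_right)
  also have "\<dots> = (\<Sum>a<m. of_real ((ip u (e a))\<^sup>2) * exp (\<theta> a))"
    by (intro sum.cong) (auto simp: c_def l2_inner_commute[of M _ u] power2_eq_square)
  finally show ?thesis by (simp add: g_def U_def)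
qed

section \<open>Multipliers and pencils of symmetric operators\<close>

lemma gen_in_H:
  assumes "k \<in> I"
  shows "\<phi> k \<in> H"
proof -
  have "(\<Sum>i\<in>I. (if i = k then 1 else 0) * \<phi> i x) = \<phi> k x" for x
  proof -
    have "(\<Sum>i\<in>I. (if i = k then 1 else 0) * \<phi> i x) = (\<Sum>i\<in>I. if i = k then \<phi> i x else 0)"
      by (intro sum.cong) auto
    then show ?thesis using assms finite_index by simp
  qed
  then show ?thesis
    unfolding H_def by (intro CollectI exI[of _ "\<lambda>i. if i = k then 1 else 0"]) simp
qed

lemma integrable_multiplier:
  assumes q: "\<And>i j. i \<in> I \<Longrightarrow> j \<in> I \<Longrightarrow> integrable M (\<lambda>x. q x * \<phi> i x * \<phi> j x)"
    and "f \<in> H" "g \<in> H"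
  shows "integrable M (\<lambda>x. q x * f x * g x)"
proof -
  obtain c d where fg: "f = (\<lambda>x. \<Sum>i\<in>I. c i * \<phi> i x)" "g = (\<lambda>x. \<Sum>i\<in>I. d i * \<phi> i x)"
    using assms by (auto simp: H_def)
  have "(\<lambda>x. q x * f x * g x) = (\<lambda>x. \<Sum>i\<in>I. \<Sum>j\<in>I. (c i * d j) * (q x * \<phi> i x * \<phi> j x))"
    unfolding fg mult.assoc sum_product by (simp add: sum_distrib_left mult_ac)
  then show ?thesis
    by (auto intro!: Bochner_Integration.integrable_sum integrable_mult_right q)
qed

context
  fixes A :: "'d::finite \<Rightarrow> ('a \<Rightarrow> real) \<Rightarrow> 'a \<Rightarrow> real"
  assumes A: "\<And>j. symmetric_on (A j)"
begin

lemma pencil_in_H: "f \<in> H \<Longrightarrow> pencil A p f \<in> H"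
  unfolding pencil_def using symmetric_onD(1)[OF A] by (intro H_sum) auto

lemma ip_pencil: "f \<in> H \<Longrightarrow> h \<in> H \<Longrightarrow> ip (pencil A p f) h = (\<Sum>j\<in>UNIV. p $ j * ip (A j f) h)"
  unfolding pencil_def using symmetric_onD(1)[OF A] by (intro ip_sum) auto

lemma symmetric_on_pencil: "symmetric_on (pencil A p)"
  unfolding symmetric_on_def
proof (intro conjI ballI)
  fix f g assume fg: "f \<in> H" "g \<in> H"
  have "ip (pencil A p f) g = (\<Sum>j\<in>UNIV. p $ j * ip (A j g) f)"
    unfolding ip_pencil[OF fg] using symmetric_onD(2)[OF A fg]
    by (intro sum.cong) (auto simp: l2_inner_commute[of M f])
  then show "ip (pencil A p f) g = ip f (pencil A p g)"
    using ip_pencil[OF fg(2,1)] by (simp add: l2_inner_commute[of M f])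
qed (rule pencil_in_H)

text \<open>The directions p in which f is an eigenvector form a subspace, because the pencil
  depends linearly on p and eigenvalues add and scale accordingly. Containing a spanning set, it
  contains the coordinate axes.\<close>

lemma eigenvector_of_spanning_pencils:
  assumes span: "span B = UNIV" and f: "f \<in> H"
    and B: "\<And>p. p \<in> B \<Longrightarrow> \<exists>\<mu>. eigenvector (pencil A p) \<mu> f"
  shows "\<exists>\<mu>. eigenvector (A j) \<mu> f"
proof -
  define S where "S = {p. \<exists>\<mu>. eigenvector (pencil A p) \<mu> f}"
  have "subspace S"
  proof (rule subspaceI)
    have "ip (pencil A 0 f) h = 0 * ip f h" if "h \<in> H" for h
      using ip_pencil[OF f that] by simp
    then show "0 \<in> S" unfolding S_def eigenvector_def by blast
  next
    fix p q assume "p \<in> S" "q \<in> S"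
    then obtain \<mu> \<nu> where *: "eigenvector (pencil A p) \<mu> f" "eigenvector (pencil A q) \<nu> f"
      by (auto simp: S_def)
    have "ip (pencil A (p + q) f) h = (\<mu> + \<nu>) * ip f h" if h: "h \<in> H" for h
    proof -
      have "ip (pencil A (p + q) f) h = ip (pencil A p f) h + ip (pencil A q f) h"
        by (simp add: ip_pencil[OF f h] algebra_simps sum.distrib)
      then show ?thesis using * h by (simp add: eigenvector_def algebra_simps)
    qed
    then show "p + q \<in> S" unfolding S_def eigenvector_def by blast
  next
    fix c p assume "p \<in> S"
    then obtain \<mu> where *: "eigenvector (pencil A p) \<mu> f" by (auto simp: S_def)
    have "ip (pencil A (c *\<^sub>R p) f) h = (c * \<mu>) * ip f h" if h: "h \<in> H" for h
    proof -
      have "ip (pencil A (c *\<^sub>R p) f) h = c * ip (pencil A p f) h"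
        by (simp add: ip_pencil[OF f h] sum_distrib_left mult.assoc)
      then show ?thesis using * h by (simp add: eigenvector_def)
    qed
    then show "c *\<^sub>R p \<in> S" unfolding S_def eigenvector_def by blast
  qed
  moreover have "B \<subseteq> S" using B by (auto simp: S_def)
  ultimately have "axis j 1 \<in> S" using span span_minimal[of B S] by auto
  then obtain \<mu> where \<mu>: "eigenvector (pencil A (axis j 1)) \<mu> f" by (auto simp: S_def)
  have "ip (pencil A (axis j 1) f) h = ip (A j f) h" if h: "h \<in> H" for h
  proof -
    have "ip (pencil A (axis j 1) f) h = (\<Sum>k\<in>UNIV. if k = j then ip (A k f) h else 0)"
      unfolding ip_pencil[OF f h] by (intro sum.cong) (auto simp: axis_def)
    then show ?thesis by simp
  qed
  then show ?thesis using \<mu> by (auto simp: eigenvector_def)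
qed

lemma joint_eigenbasis_of_commuting_pencils:
  assumes span: "span (range v) = UNIV"
    and comm: "\<And>i j :: 'k :: finite. commute_on (pencil A (v i)) (pencil A (v j))"
  shows "\<exists>m e \<Lambda>. orthonormal m e \<and>
    (\<forall>f\<in>H. AE x in M. f x = (\<Sum>a<m. ip f (e a) * e a x)) \<and>
    (\<forall>a<m. \<forall>j. eigenvector (A j) (\<Lambda> a $ j) (e a))"
proof -
  have F: "finite (range (\<lambda>i. pencil A (v i)))"
    "\<And>T. T \<in> range (\<lambda>i. pencil A (v i)) \<Longrightarrow> symmetric_on T"
    "\<And>S T. S \<in> range (\<lambda>i. pencil A (v i)) \<Longrightarrow> T \<in> range (\<lambda>i. pencil A (v i)) \<Longrightarrow> commute_on S T"
    using symmetric_on_pencil comm by auto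
  obtain m e where e: "orthonormal m e"
    and eig: "\<forall>a<m. \<forall>T\<in>range (\<lambda>i. pencil A (v i)). \<exists>\<mu>. eigenvector T \<mu> (e a)"
    and ex: "\<forall>f\<in>H. AE x in M. f x = (\<Sum>a<m. ip f (e a) * e a x)"
    using joint_eigenbasis_exists[OF F] by blast
  have "\<exists>\<mu>. eigenvector (A j) \<mu> (e a)" if a: "a < m" for a j
    using eigenvector_of_spanning_pencils[OF span orthonormalD(1)[OF e a]] eig a by blast
  then obtain \<mu> where \<mu>: "\<And>a j. a < m \<Longrightarrow> eigenvector (A j) (\<mu> a j) (e a)" by metis
  then show ?thesis
    using e ex by (intro exI[of _ m] exI[of _ e] exI[of _ "\<lambda>a. \<chi> j. \<mu> a j"]) simp
qed

end

end

section \<open>Moments of a measure of moderate growth\<close>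

text \<open>A closed ball of radius r about l lies in \<Gamma>. Pairing x with the point of the ball
  farthest from l in the direction of -x gives the bound with \<epsilon> = r.\<close>

lemma interior_coercive_on_dual_cone:
  fixes l :: "'a::real_inner"
  assumes "l \<in> interior \<Gamma>"
  shows "\<exists>\<epsilon>>0. \<forall>x\<in>dual_cone \<Gamma>. \<epsilon> * norm x \<le> l \<bullet> x"
proof -
  obtain r where r: "r > 0" "cball l r \<subseteq> \<Gamma>" using assms by (auto simp: mem_interior_cball)
  have "r * norm x \<le> l \<bullet> x" if x: "x \<in> dual_cone \<Gamma>" for x
  proof (cases "x = 0")
    case False
    have "l - (r / norm x) *\<^sub>R x \<in> cball l r"
      using r(1) False by (simp add: dist_norm)
    then have "l - (r / norm x) *\<^sub>R x \<in> \<Gamma>" using r(2) by blast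
    then have "0 \<le> x \<bullet> (l - (r / norm x) *\<^sub>R x)" using x by (simp add: dual_cone_def)
    then show ?thesis using False
      by (simp add: inner_diff_right inner_commute[of l x] dot_square_norm power2_eq_square)
  qed simp
  then show ?thesis using r(1) by blast
qed

lemma interior_convex_cone_scaleR:
  fixes l :: "'a::real_normed_vector"
  assumes "convex_cone \<Gamma>" "l \<in> interior \<Gamma>" "c > 0"
  shows "c *\<^sub>R l \<in> interior \<Gamma>"
proof -
  have "(\<lambda>x. c *\<^sub>R x) ` interior \<Gamma> \<subseteq> \<Gamma>"
    using assms interior_subset[of \<Gamma>] by (auto simp: convex_cone_iff)
  then have "(\<lambda>x. c *\<^sub>R x) ` interior \<Gamma> \<subseteq> interior \<Gamma>"
    using assms(3) by (intro interior_maximal open_scaling) auto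
  then show ?thesis using assms(2) by auto
qed

lemma moderate_growth_measurable:
  assumes "moderate_growth \<Gamma> M" "f \<in> borel_measurable borel"
  shows "f \<in> borel_measurable M"
proof -
  have "f \<in> borel_measurable (restrict_space borel (dual_cone \<Gamma>))"
    using assms(2) by (rule measurable_restrict_space1)
  moreover have "sets M = sets (restrict_space borel (dual_cone \<Gamma>))"
    using assms(1) by (simp add: moderate_growth_def)
  ultimately show ?thesis using measurable_cong_sets by blast
qed

lemma space_moderate_growth: "moderate_growth \<Gamma> M \<Longrightarrow> space M = dual_cone \<Gamma>"
  using sets_eq_imp_space_eq[of M "restrict_space borel (dual_cone \<Gamma>)"]
  by (simp add: moderate_growth_def space_restrict_space)

lemma power_div_fact_le_exp:
  fixes t :: real
  assumes "t \<ge> 0"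
  shows "t ^ k / fact k \<le> exp t"
proof -
  have s: "(\<lambda>n. t ^ n / fact n) sums exp t"
    using exp_converges[of t] by (simp add: divide_inverse mult.commute)
  then show ?thesis
    using sum_le_suminf[of "\<lambda>n. t ^ n / fact n" "{k}"] assms by (simp add: sums_iff)
qed

text \<open>The square of \<open>vac l\<close> is exp(-l . x). Half of this decay absorbs the
  polynomial; the other half is \<open>vac l\<close>, integrable by moderate growth at l/2.\<close>

lemma integrable_polynomial_growth_times_exp:
  fixes h :: "real ^ 'd \<Rightarrow> real"
  assumes \<Gamma>: "convex_cone \<Gamma>" "moderate_growth \<Gamma> M" "l \<in> interior \<Gamma>"
    and h: "continuous_on UNIV h" "\<And>x. \<bar>h x\<bar> \<le> norm x ^ k"
  shows "integrable M (\<lambda>x. h x * (vac l x * vac l x))"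
proof -
  obtain \<epsilon> where \<epsilon>: "\<epsilon> > 0" "\<And>x. x \<in> dual_cone \<Gamma> \<Longrightarrow> \<epsilon> * norm x \<le> l \<bullet> x"
    using interior_coercive_on_dual_cone[OF \<Gamma>(3)] by blast
  \<comment> \<open>From t^k / k! \<le> exp t at t = \<epsilon>/2 times the norm of x.\<close>
  define K where "K = fact k * (2 / \<epsilon>) ^ k"
  have "(1 / 2) *\<^sub>R l \<in> interior \<Gamma>" using interior_convex_cone_scaleR[OF \<Gamma>(1,3)] by simp
  then have "integrable M (vac l)" using \<Gamma>(2) unfolding moderate_growth_def vac_def by blast
  then have int: "integrable M (\<lambda>x. K * vac l x)" by simp
  have "continuous_on UNIV (\<lambda>x. h x * (vac l x * vac l x))"
    unfolding vac_def by (intro continuous_intros h)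
  then have meas: "(\<lambda>x. h x * (vac l x * vac l x)) \<in> borel_measurable M"
    using moderate_growth_measurable[OF \<Gamma>(2)] borel_measurable_continuous_onI by blast
  have bound: "\<bar>h x * (vac l x * vac l x)\<bar> \<le> K * vac l x" if x: "x \<in> space M" for x
  proof -
    have "(\<epsilon> / 2 * norm x) ^ k / fact k \<le> exp (\<epsilon> / 2 * norm x)"
      using \<epsilon>(1) by (intro power_div_fact_le_exp) auto
    then have "norm x ^ k \<le> K * exp (\<epsilon> / 2 * norm x)"
      using \<epsilon>(1) by (simp add: K_def field_simps)
    also have "\<dots> \<le> K * exp (((1 / 2) *\<^sub>R l) \<bullet> x)"
      using \<epsilon> x space_moderate_growth[OF \<Gamma>(2)] by (auto simp: K_def intro!: mult_left_mono)
    finally have "\<bar>h x\<bar> \<le> K * exp (((1 / 2) *\<^sub>R l) \<bullet> x)" using h(2)[of x] by simp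
    then have "\<bar>h x\<bar> * (vac l x * vac l x) \<le> K * exp (((1 / 2) *\<^sub>R l) \<bullet> x) * (vac l x * vac l x)"
      by (intro mult_right_mono) (auto simp: vac_def)
    also have "\<dots> = K * vac l x"
      by (simp add: vac_def flip: exp_add)
    finally show ?thesis by (simp add: abs_mult vac_def)
  qed
  show ?thesis
    using int meas by (rule Bochner_Integration.integrable_bound)
      (use bound in \<open>auto intro!: AE_I2 order_trans[OF bound]\<close>)
qed

lemma abs_monomial_le_norm_power:
  fixes x :: "real ^ 'd"
  shows "\<bar>\<Prod>i\<in>UNIV. (x $ i) ^ \<alpha> i\<bar> \<le> norm x ^ (\<Sum>i\<in>UNIV. \<alpha> i)"
proof -
  have "(\<Prod>i\<in>UNIV. \<bar>x $ i\<bar> ^ \<alpha> i) \<le> (\<Prod>i\<in>UNIV. norm x ^ \<alpha> i)"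
    by (intro prod_mono) (auto intro: power_mono component_le_norm_cart)
  then show ?thesis by (simp add: abs_prod power_abs power_sum)
qed

lemma l2_span_Hsp:
  fixes M :: "(real ^ 'd) measure"
  assumes \<Gamma>: "convex_cone \<Gamma>" "moderate_growth \<Gamma> M" "l \<in> interior \<Gamma>"
  shows "l2_span M {\<alpha> :: 'd \<Rightarrow> nat. (\<Sum>i\<in>UNIV. \<alpha> i) \<le> n} (\<lambda>\<alpha> x. (\<Prod>i\<in>UNIV. (x $ i) ^ \<alpha> i) * vac l x)"
proof
  have "\<alpha> i \<le> (\<Sum>i\<in>UNIV. \<alpha> i)" for \<alpha> :: "'d \<Rightarrow> nat" and i
    by (rule member_le_sum) auto
  then have "{\<alpha> :: 'd \<Rightarrow> nat. (\<Sum>i\<in>UNIV. \<alpha> i) \<le> n} \<subseteq> PiE UNIV (\<lambda>_. {..n})"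
    by (auto intro: order_trans)
  then show "finite {\<alpha> :: 'd \<Rightarrow> nat. (\<Sum>i\<in>UNIV. \<alpha> i) \<le> n}"
    by (rule finite_subset) (auto intro: finite_PiE)
next
  fix \<alpha> \<beta> :: "'d \<Rightarrow> nat"
  have "continuous_on UNIV (\<lambda>x :: real ^ 'd. (\<Prod>i\<in>UNIV. (x $ i) ^ \<alpha> i) * vac l x)"
    unfolding vac_def by (intro continuous_intros)
  then show "(\<lambda>x. (\<Prod>i\<in>UNIV. (x $ i) ^ \<alpha> i) * vac l x) \<in> borel_measurable M"
    using moderate_growth_measurable[OF \<Gamma>(2)] borel_measurable_continuous_onI by blast
  define h where "h = (\<lambda>x :: real ^ 'd. (\<Prod>i\<in>UNIV. (x $ i) ^ \<alpha> i) * (\<Prod>i\<in>UNIV. (x $ i) ^ \<beta> i))"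
  have "integrable M (\<lambda>x. h x * (vac l x * vac l x))"
  proof (rule integrable_polynomial_growth_times_exp[OF \<Gamma>])
    show "continuous_on UNIV h" unfolding h_def by (intro continuous_intros)
    show "\<bar>h x\<bar> \<le> norm x ^ (sum \<alpha> UNIV + sum \<beta> UNIV)" for x
      using mult_mono[OF abs_monomial_le_norm_power[of x \<alpha>] abs_monomial_le_norm_power[of x \<beta>]]
      by (simp add: h_def abs_mult power_add)
  qed
  then show "integrable M (\<lambda>x. (\<Prod>i\<in>UNIV. (x $ i) ^ \<alpha> i) * vac l x * ((\<Prod>i\<in>UNIV. (x $ i) ^ \<beta> i) * vac l x))"
    by (simp add: h_def mult_ac)
qed

text \<open>Multiplication by a coordinate can raise the degree past n and leave
  \<open>Hsp l n\<close>; these integrals are what the compression back to it requires.\<close>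

lemma integrable_coord_monomials:
  fixes M :: "(real ^ 'd) measure"
  assumes \<Gamma>: "convex_cone \<Gamma>" "moderate_growth \<Gamma> M" "l \<in> interior \<Gamma>"
  shows "integrable M (\<lambda>x. x $ j * ((\<Prod>i\<in>UNIV. (x $ i) ^ \<alpha> i) * vac l x)
    * ((\<Prod>i\<in>UNIV. (x $ i) ^ \<beta> i) * vac l x))"
proof -
  define h where "h = (\<lambda>x :: real ^ 'd. x $ j * ((\<Prod>i\<in>UNIV. (x $ i) ^ \<alpha> i) * (\<Prod>i\<in>UNIV. (x $ i) ^ \<beta> i)))"
  have "integrable M (\<lambda>x. h x * (vac l x * vac l x))"
  proof (rule integrable_polynomial_growth_times_exp[OF \<Gamma>])
    show "continuous_on UNIV h" unfolding h_def by (intro continuous_intros)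
    show "\<bar>h x\<bar> \<le> norm x ^ (1 + (sum \<alpha> UNIV + sum \<beta> UNIV))" for x
      unfolding h_def abs_mult power_add
      by (intro mult_mono abs_monomial_le_norm_power) (auto intro: component_le_norm_cart)
  qed
  then show ?thesis by (simp add: h_def mult_ac)
qed

section \<open>The matrix coefficient as a finite sum of exponentials\<close>

theorem corollary7p3:
  fixes \<Gamma> :: "(real ^ 'd) set"
    and M :: "(real ^ 'd) measure"
    and l :: "real ^ 'd"
    and n :: nat
  assumes "convex_cone \<Gamma>" and "closed \<Gamma>" and "acute \<Gamma>" and "solid \<Gamma>"
    and "moderate_growth \<Gamma> M"
    and "l \<in> interior \<Gamma>"
    and "\<And>p. on_extreme_ray p \<Gamma> \<Longrightarrow>
           pos_semidef_on M (Hsp l n) (pencil (compressed_coord M l n) p)"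
    and "\<exists>v :: 'd \<Rightarrow> real ^ 'd.
           inj v \<and> independent (range v) \<and> (\<forall>i. on_extreme_ray (v i) \<Gamma>) \<and>
           (\<forall>i j. \<forall>k\<ge>1. pos_semidef_on M (Hsp l n)
              (weyl_word k (pencil (compressed_coord M l n) (v i))
                           (pencil (compressed_coord M l n) (v j))))"
  shows "\<exists>(\<gamma> :: nat \<Rightarrow> real) (\<Lambda> :: nat \<Rightarrow> real ^ 'd).
           (\<forall>j\<in>{1..ae_dim M (Hsp l n)}. \<gamma> j \<ge> 0 \<and> \<Lambda> j \<in> dual_cone \<Gamma>) \<and>
           (\<forall>z\<in>tube l \<Gamma>.
              exp_matrix_coeff M l n z =
                (\<Sum>j = 1..ae_dim M (Hsp l n).
                   of_real (\<gamma> j) *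
                   exp (- (\<Sum>i\<in>UNIV. (z $ i - of_real (l $ i)) * of_real (\<Lambda> j $ i)))))"
proof -
  note \<Gamma> = assms(1) assms(5) assms(6)
  interpret l2_span M "{\<alpha> :: 'd \<Rightarrow> nat. (\<Sum>i\<in>UNIV. \<alpha> i) \<le> n}"
    "\<lambda>\<alpha> x. (\<Prod>i\<in>UNIV. (x $ i) ^ \<alpha> i) * vac l x"
    by (rule l2_span_Hsp[OF \<Gamma>])
  have H_eq: "Hsp l n = H" by (simp add: Hsp_def H_def)
  define A where "A = compressed_coord M l n"
  have int: "integrable M (\<lambda>x. x $ j * f x * g x)" if "f \<in> H" "g \<in> H" for f g j
    by (rule integrable_multiplier[OF integrable_coord_monomials[OF \<Gamma>] that])
  have A_def': "A j = (\<lambda>f. orth_proj M H (\<lambda>x. x $ j * orth_proj M H f x))" for j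
    by (simp add: A_def compressed_coord_def H_eq)
  have A_H: "A j f \<in> H" if "f \<in> H" for j f
    unfolding A_def' by (rule compressed_multiplier(1)[OF int that])
  have ip_A: "ip (A j f) g = (LINT x|M. x $ j * f x * g x)" if "f \<in> H" "g \<in> H" for j f g
    unfolding A_def' by (rule compressed_multiplier(2)[OF int that])
  have sym: "symmetric_on (A j)" for j
    unfolding symmetric_on_def
  proof (intro conjI ballI A_H)
    fix f g assume fg: "f \<in> H" "g \<in> H"
    then show "ip (A j f) g = ip f (A j g)"
      by (simp add: l2_inner_commute[of M f] ip_A mult_ac)
  qed
  obtain v :: "'d \<Rightarrow> real ^ 'd" where v: "inj v" "independent (range v)"
      "\<And>i. on_extreme_ray (v i) \<Gamma>"
      "\<And>i j k. k \<ge> 1 \<Longrightarrow> pos_semidef_on M H (weyl_word k (pencil A (v i)) (pencil A (v j)))"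
    using assms(8) unfolding A_def[symmetric] H_eq by blast
  \<comment> \<open>Injectivity of \<open>v\<close> makes its range a set of as many vectors as the
    dimension of the space, hence a basis.\<close>
  have "dim (range v) = DIM(real ^ 'd)"
    using v by (simp add: dim_eq_card_independent card_image)
  then have span: "span (range v) = UNIV" by (simp only: dim_eq_full)
  have comm: "commute_on (pencil A (v i)) (pencil A (v j))" for i j
    using assms(7)[OF v(3)] v(4)
    by (intro weyl_words_psd_imp_commute symmetric_on_pencil sym) (auto simp: A_def H_eq)
  obtain m e \<Lambda> where e: "orthonormal m e"
    and ex: "\<And>f. f \<in> H \<Longrightarrow> AE x in M. f x = (\<Sum>a<m. ip f (e a) * e a x)"
    and eig: "\<And>a j. a < m \<Longrightarrow> eigenvector (A j) (\<Lambda> a $ j) (e a)"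
    using joint_eigenbasis_of_commuting_pencils[OF sym span comm] by blast
  have \<Lambda>: "\<Lambda> a \<in> dual_cone \<Gamma>" if a: "a < m" for a
    unfolding dual_cone_def
  proof (intro CollectI ballI)
    fix p assume p: "p \<in> \<Gamma>"
    note ea = orthonormalD(1)[OF e a]
    have "\<Lambda> a $ j = (LINT x|M. x $ j * e a x * e a x)" for j
    proof -
      have "ip (A j (e a)) (e a) = \<Lambda> a $ j * ip (e a) (e a)"
        using eig[OF a, of j] ea unfolding eigenvector_def by blast
      then show ?thesis using orthonormalD(2)[OF e a a] by (simp add: ip_A[OF ea ea])
    qed
    then have "\<Lambda> a \<bullet> p = (\<Sum>j\<in>UNIV. (LINT x|M. p $ j * (x $ j * e a x * e a x)))"
      by (simp add: inner_vec_def mult.commute)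
    also have "\<dots> = (LINT x|M. (\<Sum>j\<in>UNIV. p $ j * (x $ j * e a x * e a x)))"
      using int[OF ea ea] by (subst Bochner_Integration.integral_sum) auto
    also have "\<dots> = (LINT x|M. (x \<bullet> p) * (e a x)\<^sup>2)"
      by (simp add: inner_vec_def sum_distrib_left sum_distrib_right power2_eq_square mult_ac)
    also have "\<dots> \<ge> 0"
      using p space_moderate_growth[OF assms(5)]
      by (intro integral_nonneg_AE AE_I2) (auto simp: dual_cone_def)
    finally show "0 \<le> \<Lambda> a \<bullet> p" .
  qed
  have u: "vac l \<in> H"
    \<comment> \<open>The exponent 0 gives the constant monomial times \<open>vac l\<close>.\<close>
    using gen_in_H[of "\<lambda>_. 0"] by simp
  have "(\<Sum>j\<in>UNIV. (- (z - of_real_vec l)) $ j * of_real (\<Lambda> a $ j)) =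
      - (\<Sum>i\<in>UNIV. (z $ i - of_real (l $ i)) * of_real (\<Lambda> a $ i))" for z a
    unfolding sum_negf[symmetric] by (intro sum.cong) (auto simp: of_real_vec_def algebra_simps)
  moreover have "exp_matrix_coeff M l n z = (\<Sum>a<m. of_real ((ip (vac l) (e a))\<^sup>2) *
      exp (\<Sum>j\<in>UNIV. (- (z - of_real_vec l)) $ j * of_real (\<Lambda> a $ j)))" for z
    unfolding exp_matrix_coeff_def H_eq A_def[symmetric]
    by (rule l2_inner_op_exp[OF e ex pencil_c_in_complexify_space[OF sym]
          pencil_c_eigenbasis_expand[OF sym e eig] u])
  ultimately have coeff: "exp_matrix_coeff M l n z = (\<Sum>a<m. of_real ((ip (vac l) (e a))\<^sup>2) *
      exp (- (\<Sum>i\<in>UNIV. (z $ i - of_real (l $ i)) * of_real (\<Lambda> a $ i))))" for z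
    by simp
  define N where "N = ae_dim M (Hsp l n)"
  have "m \<le> N" using le_ae_dim[OF e ex] by (simp add: N_def H_eq)
  \<comment> \<open>The basis is indexed from 0 and the required sum from 1, hence
    \<open>j - 1\<close>. Indices beyond m get coefficient 0 and the vector 0, which lies in every
    dual cone.\<close>
  define \<gamma> where "\<gamma> j = (if j \<le> m then (ip (vac l) (e (j - 1)))\<^sup>2 else 0)" for j
  define \<Lambda>' where "\<Lambda>' j = (if j \<le> m then \<Lambda> (j - 1) else 0)" for j
  have "(\<Sum>j = 1..N. of_real (\<gamma> j) * exp (- (\<Sum>i\<in>UNIV. (z $ i - of_real (l $ i)) * of_real (\<Lambda>' j $ i))))
      = exp_matrix_coeff M l n z" for z
  proof -
    have "(\<Sum>j = 1..N. of_real (\<gamma> j) * exp (- (\<Sum>i\<in>UNIV. (z $ i - of_real (l $ i)) * of_real (\<Lambda>' j $ i))))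
      = (\<Sum>j = 1..m. of_real (\<gamma> j) * exp (- (\<Sum>i\<in>UNIV. (z $ i - of_real (l $ i)) * of_real (\<Lambda>' j $ i))))"
      using \<open>m \<le> N\<close> by (intro sum.mono_neutral_right) (auto simp: \<gamma>_def)
    also have "\<dots> = exp_matrix_coeff M l n z"
      unfolding coeff
      by (rule sum.reindex_bij_witness[of _ Suc "\<lambda>j. j - 1"]) (auto simp: \<gamma>_def \<Lambda>'_def)
    finally show ?thesis .
  qed
  moreover have "\<gamma> j \<ge> 0 \<and> \<Lambda>' j \<in> dual_cone \<Gamma>" if "j \<in> {1..N}" for j
    using that \<Lambda>[of "j - 1"] by (auto simp: \<gamma>_def \<Lambda>'_def dual_cone_def)
  ultimately show ?thesis unfolding N_def by (intro exI[of _ \<gamma>] exI[of _ \<Lambda>']) auto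
qed

end
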